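(* Let $\vec\ell\in\mathbb N^n$, let $\mathcal M$ be a weighted $\widetilde{gl}(\infty)$-module generated by a subspace $\mathcal M_0$ such that $\widetilde{gl}^m(\infty)(\mathcal M_0)=\{0\}$ for some $m\in\mathbb N$, and let $\iota\in\mathbb C$ with $\iota\notin\mathbb Z$. Then the representation $\sigma^\iota_{\mathcal M}$ of $\widehat{gl}(\vec\ell,\mathbb A)$ on $\mathcal M$ is irreducible if and only if $\mathcal M$ is an irreducible $\widetilde{gl}(\infty)$-module.
   Context: All spaces are over $\mathbb C$; $\mathbb N$ = nonnegative integers; $\overline{1,n}=\{1,\dots,n\}$; $\mathcal Z=\mathbb Z+1/2$; $\langle\mu\rangle_0=1$, $\langle\mu\rangle_m=\mu(\mu-1)\cdots(\mu-m+1)$. $\partial_t=d/dt$, $\mathbb A=\sum_{i\ge0}\mathbb C[t,t^{-1}]\partial_t^i$ (differential operators), $E_{i,j}$ the $n\times n$ matrix units. $\widehat{gl}(n,\mathbb A)=M_{n\times n}(\mathbb A)\oplus\mathbb C\kappa$ has $\kappa$ central and $$[t^{m_1}\partial_t^{r_1}E_{i_1,j_1},t^{m_2}\partial_t^{r_2}E_{i_2,j_2}]=\delta_{j_1,i_2}t^{m_1}\partial_t^{r_1}\cdot t^{m_2}\partial_t^{r_2}E_{i_1,j_2}-\delta_{i_1,j_2}t^{m_2}\partial_t^{r_2}\cdot t^{m_1}\partial_t^{r_1}E_{i_2,j_1}+(-1)^{r_1}\delta_{i_1,j_2}\delta_{j_1,i_2}\delta_{r_1+r_2,m_1+m_2}r_1!r_2!\binom{m_1}{r_1+r_2+1}\kappa,$$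 and $\widehat{gl}(\vec\ell,\mathbb A)=\sum_{i,j}\mathbb A\partial_t^{\ell_j}E_{i,j}+\mathbb C\kappa$ is a Lie subalgebra. $\overline{gl}(\infty)$ has basis $\{\mathcal E_{l,k}\mid l,k\in\mathcal Z\}$ with $\mathcal E_{l_1,l_2}\mathcal E_{k_1,k_2}=\delta_{l_2+k_1,0}\mathcal E_{l_1,k_2}$; $\widetilde{gl}(\infty)=\overline{gl}(\infty)\oplus\mathbb C\kappa_0$ with $\kappa_0$ central and $$[\mathcal E_{l_1,l_2},\mathcal E_{k_1,k_2}]=\mathcal E_{l_1,l_2}\mathcal E_{k_1,k_2}-\mathcal E_{k_1,k_2}\mathcal E_{l_1,l_2}+\delta_{l_1+k_2,0}\delta_{l_2+k_1,0}[H(l_1)H(l_2)-H(k_1)H(k_2)]\kappa_0,$$ $H(l)=1$ for $l>0$, $0$ for $l<0$. $\mathcal T=\sum_{l\in\mathcal Z}\mathbb C\mathcal E_{l,-l}+\mathbb C\kappa_0$; a module is weighted if it is the direct sum of its $\mathcal T$-weight spaces. $\widetilde{gl}^m(\infty)=\mathrm{Span}\{\mathcal E_{l_1,-l_2},\mathcal E_{-l_1,l_2}\mid l_1,l_2\in\mathcal Z,\ l_1,l_2>m\}$. The representation $\sigma^\iota_{\mathcal M}$ is given by $\sigma^\iota_{\mathcal M}(\kappa)=\kappa_0$ and $$\sigma^\iota_{\mathcal M}(t^m\partial_t^rE_{i,j})=\sum_{l\in\mathbb Z}\langle\iota-l\rangle_r\,\mathcal E_{(m-r-l)n+i-1/2,\,ln-j+1/2}+r!\,\delta_{i,j}\delta_{r,m}\Im_{0,r}\,\kappa_0\qquad(m\in\mathbb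 Z,\ r\in\mathbb N),$$ where $\sum_{r_1,r_2\ge0}\Im_{r_1,r_2}x^{r_1}y^{r_2}z^{-r_1-r_2-1}=\frac1{x-y}\bigl((\frac{z+y}{z+x})^\iota-1\bigr)$, expanded in nonnegative powers of $x,y$. (This formula defines a representation of all of $\widehat{gl}(n,\mathbb A)$; here it is restricted to $\widehat{gl}(\vec\ell,\mathbb A)$.) *)

theory Defs
  imports
    Complex_Main
    "HOL-Library.Poly_Mapping"
    "HOL-Library.Groups_Big_Fun"
    "HOL-Computational_Algebra.Formal_Power_Series"
begin

unbundle fps_syntax

text \<open>A complex vector space with basis \<open>'b\<close> is the type \<open>'b \<Rightarrow>\<^sub>0 complex\<close> of finitely supported
  functions. Lie algebras are subspaces (carriers) of such spaces with the bracket given by bilinear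
  extension of its values on basis elements.\<close>

definition fscale :: "complex \<Rightarrow> ('b \<Rightarrow>\<^sub>0 complex) \<Rightarrow> ('b \<Rightarrow>\<^sub>0 complex)" where
  "fscale c = Poly_Mapping.map (\<lambda>z. c * z)"

definition lin_ext ::
  "(complex \<Rightarrow> 'v \<Rightarrow> 'v) \<Rightarrow> ('b \<Rightarrow> 'v) \<Rightarrow> ('b \<Rightarrow>\<^sub>0 complex) \<Rightarrow> 'v::ab_group_add" where
  "lin_ext s f x = (\<Sum>b\<in>Poly_Mapping.keys x. s (Poly_Mapping.lookup x b) (f b))"

definition bilin_ext ::
  "('a \<Rightarrow> 'b \<Rightarrow> ('c \<Rightarrow>\<^sub>0 complex)) \<Rightarrow> ('a \<Rightarrow>\<^sub>0 complex) \<Rightarrow> ('b \<Rightarrow>\<^sub>0 complex) \<Rightarrow> ('c \<Rightarrow>\<^sub>0 complex)" where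
  "bilin_ext B x y = lin_ext fscale (\<lambda>a. lin_ext fscale (B a) y) x"

abbreviation basis :: "'b \<Rightarrow> ('b \<Rightarrow>\<^sub>0 complex)" where
  "basis b \<equiv> Poly_Mapping.single b 1"


section \<open>Modules over Lie algebras\<close>

text \<open>The module is the whole type \<open>'v\<close> with complex scalar multiplication \<open>s\<close>; the Lie algebra has
  carrier \<open>L\<close>, and nothing is required of the action of elements outside \<open>L\<close>.\<close>

locale lie_module = vector_space s
  for L :: "('b \<Rightarrow>\<^sub>0 complex) set"
    and br :: "('b \<Rightarrow>\<^sub>0 complex) \<Rightarrow> ('b \<Rightarrow>\<^sub>0 complex) \<Rightarrow> ('b \<Rightarrow>\<^sub>0 complex)"
    and s :: "complex \<Rightarrow> 'v::ab_group_add \<Rightarrow> 'v"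
    and act :: "('b \<Rightarrow>\<^sub>0 complex) \<Rightarrow> 'v \<Rightarrow> 'v" +
  assumes act_add_right: "x \<in> L \<Longrightarrow> act x (v + w) = act x v + act x w"
    and act_scale_right: "x \<in> L \<Longrightarrow> act x (s c v) = s c (act x v)"
    and act_add_left: "x \<in> L \<Longrightarrow> y \<in> L \<Longrightarrow> act (x + y) v = act x v + act y v"
    and act_scale_left: "x \<in> L \<Longrightarrow> act (fscale c x) v = s c (act x v)"
    and act_bracket: "x \<in> L \<Longrightarrow> y \<in> L \<Longrightarrow> act (br x y) v = act x (act y v) - act y (act x v)"

definition lie_submodule ::
  "('b \<Rightarrow>\<^sub>0 complex) set \<Rightarrow> (complex \<Rightarrow> 'v::ab_group_add \<Rightarrow> 'v) \<Rightarrow> (('b \<Rightarrow>\<^sub>0 complex) \<Rightarrow> 'v \<Rightarrow> 'v)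
     \<Rightarrow> 'v set \<Rightarrow> bool" where
  "lie_submodule L s act N \<longleftrightarrow> module.subspace s N \<and> (\<forall>x\<in>L. \<forall>v\<in>N. act x v \<in> N)"

definition irreducible_lie_module ::
  "('b \<Rightarrow>\<^sub>0 complex) set \<Rightarrow> (('b \<Rightarrow>\<^sub>0 complex) \<Rightarrow> ('b \<Rightarrow>\<^sub>0 complex) \<Rightarrow> ('b \<Rightarrow>\<^sub>0 complex))
     \<Rightarrow> (complex \<Rightarrow> 'v::ab_group_add \<Rightarrow> 'v) \<Rightarrow> (('b \<Rightarrow>\<^sub>0 complex) \<Rightarrow> 'v \<Rightarrow> 'v) \<Rightarrow> bool" where
  "irreducible_lie_module L br s act \<longleftrightarrow>
     lie_module L br s act \<and> (UNIV :: 'v set) \<noteq> {0} \<and>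
     (\<forall>N. lie_submodule L s act N \<longrightarrow> N = {0} \<or> N = UNIV)"


section \<open>The Lie algebra of differential operators with matrix coefficients\<close>

definition ffact :: "complex \<Rightarrow> nat \<Rightarrow> complex" where
  "ffact \<mu> m = (\<Prod>k<m. \<mu> - of_nat k)"

text \<open>The pair \<open>(m, r)\<close> is the basis element \<open>t\<^sup>m \<partial>\<^sup>r\<close> of the algebra of differential operators.\<close>

type_synonym diffop = "(int \<times> nat) \<Rightarrow>\<^sub>0 complex"

text \<open>Composition, by the Leibniz rule
  \<open>\<partial>\<^sup>r \<cdot> t\<^sup>m = (\<Sum>k\<le>r. (r choose k) \<langle>m\<rangle>\<^sub>k t\<^bsup>m-k\<^esup> \<partial>\<^bsup>r-k\<^esup>)\<close>.\<close>

fun diffop_basis_mult :: "int \<times> nat \<Rightarrow> int \<times> nat \<Rightarrow> diffop" where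
  "diffop_basis_mult (m1, r1) (m2, r2) =
     (\<Sum>k\<le>r1. Poly_Mapping.single (m1 + m2 - int k, r1 + r2 - k)
                (of_nat (r1 choose k) * ffact (of_int m2) k))"

definition diffop_mult :: "diffop \<Rightarrow> diffop \<Rightarrow> diffop" where
  "diffop_mult = bilin_ext diffop_basis_mult"

text \<open>\<open>TD m r i j\<close> stands for \<open>t\<^sup>m \<partial>\<^sup>r E\<^bsub>i,j\<^esub>\<close>, where the matrix indices are \<open>1, \<dots>, n\<close>.\<close>

datatype hat_index = TD int nat nat nat | Kappa

definition dmat :: "diffop \<Rightarrow> nat \<Rightarrow> nat \<Rightarrow> (hat_index \<Rightarrow>\<^sub>0 complex)" where
  "dmat a i j = lin_ext fscale (\<lambda>(m, r). basis (TD m r i j)) a"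

fun gl_hat_basis_bracket :: "hat_index \<Rightarrow> hat_index \<Rightarrow> (hat_index \<Rightarrow>\<^sub>0 complex)" where
  "gl_hat_basis_bracket (TD m1 r1 i1 j1) (TD m2 r2 i2 j2) =
     (if j1 = i2 then dmat (diffop_mult (basis (m1, r1)) (basis (m2, r2))) i1 j2 else 0)
     - (if i1 = j2 then dmat (diffop_mult (basis (m2, r2)) (basis (m1, r1))) i2 j1 else 0)
     + (if i1 = j2 \<and> j1 = i2 \<and> int (r1 + r2) = m1 + m2
        then Poly_Mapping.single Kappa
               ((- 1) ^ r1 * fact r1 * fact r2 * (of_int m1 gchoose (r1 + r2 + 1)))
        else 0)"
| "gl_hat_basis_bracket Kappa y = 0"
| "gl_hat_basis_bracket x Kappa = 0"

definition gl_hat_bracket ::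
  "(hat_index \<Rightarrow>\<^sub>0 complex) \<Rightarrow> (hat_index \<Rightarrow>\<^sub>0 complex) \<Rightarrow> (hat_index \<Rightarrow>\<^sub>0 complex)" where
  "gl_hat_bracket = bilin_ext gl_hat_basis_bracket"

definition gl_hat :: "nat \<Rightarrow> (hat_index \<Rightarrow>\<^sub>0 complex) set" where
  "gl_hat n =
     {(\<Sum>i=1..n. \<Sum>j=1..n. dmat (a i j) i j) + Poly_Mapping.single Kappa c | a c. True}"

text \<open>Only the values \<open>ell j\<close> with \<open>1 \<le> j \<le> n\<close> matter.\<close>

definition gl_hat_sub :: "nat \<Rightarrow> (nat \<Rightarrow> nat) \<Rightarrow> (hat_index \<Rightarrow>\<^sub>0 complex) set" where
  "gl_hat_sub n ell =
     {(\<Sum>i=1..n. \<Sum>j=1..n. dmat (diffop_mult (a i j) (basis (0, ell j))) i j)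
        + Poly_Mapping.single Kappa c | a c. True}"


section \<open>The central extension of infinite matrices\<close>

definition half_ints :: "rat set" where
  "half_ints = {of_int k + 1 / 2 | k. True}"

text \<open>\<open>EE l k\<close> stands for the basis element with indices \<open>l\<close> and \<open>k\<close>, which are half-integers in all
  elements of the carrier \<open>gl_tilde\<close>.\<close>

datatype tilde_index = EE rat rat | Kappa0

definition gl_tilde :: "(tilde_index \<Rightarrow>\<^sub>0 complex) set" where
  "gl_tilde =
     {x. Poly_Mapping.keys x \<subseteq> insert Kappa0 {EE l k | l k. l \<in> half_ints \<and> k \<in> half_ints}}"

definition heavi :: "rat \<Rightarrow> complex" where
  "heavi l = (if l > 0 then 1 else 0)"

fun EE_mult :: "rat \<times> rat \<Rightarrow> rat \<times> rat \<Rightarrow> (tilde_index \<Rightarrow>\<^sub>0 complex)" where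
  "EE_mult (l1, l2) (k1, k2) = (if l2 + k1 = 0 then basis (EE l1 k2) else 0)"

fun gl_tilde_basis_bracket :: "tilde_index \<Rightarrow> tilde_index \<Rightarrow> (tilde_index \<Rightarrow>\<^sub>0 complex)" where
  "gl_tilde_basis_bracket (EE l1 l2) (EE k1 k2) =
     EE_mult (l1, l2) (k1, k2) - EE_mult (k1, k2) (l1, l2)
     + (if l1 + k2 = 0 \<and> l2 + k1 = 0
        then Poly_Mapping.single Kappa0 (heavi l1 * heavi l2 - heavi k1 * heavi k2) else 0)"
| "gl_tilde_basis_bracket Kappa0 y = 0"
| "gl_tilde_basis_bracket x Kappa0 = 0"

definition gl_tilde_bracket ::
  "(tilde_index \<Rightarrow>\<^sub>0 complex) \<Rightarrow> (tilde_index \<Rightarrow>\<^sub>0 complex) \<Rightarrow> (tilde_index \<Rightarrow>\<^sub>0 complex)" where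
  "gl_tilde_bracket = bilin_ext gl_tilde_basis_bracket"

definition gl_tilde_trunc :: "nat \<Rightarrow> (tilde_index \<Rightarrow>\<^sub>0 complex) set" where
  "gl_tilde_trunc m = module.span fscale
     ({basis (EE l1 (- l2)) | l1 l2. l1 \<in> half_ints \<and> l2 \<in> half_ints \<and> l1 > of_nat m \<and> l2 > of_nat m}
      \<union> {basis (EE (- l1) l2) | l1 l2. l1 \<in> half_ints \<and> l2 \<in> half_ints \<and> l1 > of_nat m \<and> l2 > of_nat m})"

definition gl_tilde_torus :: "(tilde_index \<Rightarrow>\<^sub>0 complex) set" where
  "gl_tilde_torus =
     module.span fscale (insert (basis Kappa0) {basis (EE l (- l)) | l. l \<in> half_ints})"

definition weight_space ::
  "(complex \<Rightarrow> 'v::ab_group_add \<Rightarrow> 'v) \<Rightarrow> ((tilde_index \<Rightarrow>\<^sub>0 complex) \<Rightarrow> 'v \<Rightarrow> 'v)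
     \<Rightarrow> ((tilde_index \<Rightarrow>\<^sub>0 complex) \<Rightarrow> complex) \<Rightarrow> 'v set" where
  "weight_space s act \<mu> = {v. \<forall>h\<in>gl_tilde_torus. act h v = s (\<mu> h) v}"

definition weight_spaces ::
  "(complex \<Rightarrow> 'v::ab_group_add \<Rightarrow> 'v) \<Rightarrow> ((tilde_index \<Rightarrow>\<^sub>0 complex) \<Rightarrow> 'v \<Rightarrow> 'v) \<Rightarrow> 'v set set" where
  "weight_spaces s act = {weight_space s act \<mu> | \<mu>. Vector_Spaces.linear fscale (*) \<mu>}"

text \<open>A set of subspaces, rather than a family over functionals, because functionals on the
  ambient space with the same restriction to the torus give the same weight space.\<close>

definition internal_direct_sum :: "'v::ab_group_add set set \<Rightarrow> bool" where
  "internal_direct_sum W \<longleftrightarrow>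
     (\<forall>v. \<exists>!f :: 'v set \<Rightarrow> 'v.
        (\<forall>U\<in>W. f U \<in> U) \<and> (\<forall>U. U \<notin> W \<longrightarrow> f U = 0) \<and> finite {U. f U \<noteq> 0} \<and>
        v = (\<Sum>U | f U \<noteq> 0. f U))"

definition weighted ::
  "(complex \<Rightarrow> 'v::ab_group_add \<Rightarrow> 'v) \<Rightarrow> ((tilde_index \<Rightarrow>\<^sub>0 complex) \<Rightarrow> 'v \<Rightarrow> 'v) \<Rightarrow> bool" where
  "weighted s act \<longleftrightarrow> internal_direct_sum (weight_spaces s act)"


section \<open>The representation\<close>

text \<open>Bivariate formal power series in \<open>x\<close> (outer variable) and \<open>y\<close> (inner variable). The generating
  function \<open>(((z + y) / (z + x))\<^sup>\<iota> - 1) / (x - y)\<close> is homogeneous of degree \<open>-1\<close>, so nothing is lost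
  by setting \<open>z = 1\<close>; \<open>(1 + y)\<^sup>\<iota>\<close> is the binomial series.\<close>

definition J_numerator :: "complex \<Rightarrow> complex fps fps" where
  "J_numerator \<iota> =
     fps_const (fps_binomial \<iota>) * Abs_fps (\<lambda>a. fps_const (fps_binomial (- \<iota>) $ a)) - 1"

definition J_series :: "complex \<Rightarrow> complex fps fps" where
  "J_series \<iota> = (THE F. (fps_X - fps_const fps_X) * F = J_numerator \<iota>)"

definition J_coeff :: "complex \<Rightarrow> nat \<Rightarrow> nat \<Rightarrow> complex" where
  "J_coeff \<iota> r1 r2 = J_series \<iota> $ r1 $ r2"

text \<open>The sum over \<open>l\<close> is meant pointwise: \<open>Sum_any\<close> is the sum over the nonzero terms, of which there
  are finitely many for each vector \<open>v\<close> of the modules under consideration.\<close>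

fun sigma_basis ::
  "nat \<Rightarrow> complex \<Rightarrow> (complex \<Rightarrow> 'v::ab_group_add \<Rightarrow> 'v) \<Rightarrow> ((tilde_index \<Rightarrow>\<^sub>0 complex) \<Rightarrow> 'v \<Rightarrow> 'v)
     \<Rightarrow> hat_index \<Rightarrow> 'v \<Rightarrow> 'v" where
  "sigma_basis n \<iota> s act (TD m r i j) v =
     Sum_any (\<lambda>l::int. s (ffact (\<iota> - of_int l) r)
       (act (basis (EE (of_int ((m - int r - l) * int n + int i) - 1 / 2)
                       (of_int (l * int n - int j) + 1 / 2))) v))
     + s (if i = j \<and> int r = m then fact r * J_coeff \<iota> 0 r else 0) (act (basis Kappa0) v)"
| "sigma_basis n \<iota> s act Kappa v = act (basis Kappa0) v"

definition sigma ::
  "nat \<Rightarrow> complex \<Rightarrow> (complex \<Rightarrow> 'v::ab_group_add \<Rightarrow> 'v) \<Rightarrow> ((tilde_index \<Rightarrow>\<^sub>0 complex) \<Rightarrow> 'v \<Rightarrow> 'v)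
     \<Rightarrow> (hat_index \<Rightarrow>\<^sub>0 complex) \<Rightarrow> 'v \<Rightarrow> 'v" where
  "sigma n \<iota> s act x v = lin_ext s (\<lambda>b. sigma_basis n \<iota> s act b v) x"


section \<open>Consistency checks\<close>

lemma lookup_fscale: "Poly_Mapping.lookup (fscale c x) k = c * Poly_Mapping.lookup x k"
  by (simp add: fscale_def Poly_Mapping.map.rep_eq when_def)

lemma vector_space_fscale: "vector_space (fscale :: complex \<Rightarrow> ('b \<Rightarrow>\<^sub>0 complex) \<Rightarrow> _)"
  by unfold_locales (simp_all add: poly_mapping_eq_iff fun_eq_iff lookup_fscale lookup_add algebra_simps)

lemma gl_hat_sub_subset: "gl_hat_sub n ell \<subseteq> gl_hat n"
proof
  fix x assume "x \<in> gl_hat_sub n ell"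
  then obtain a c where "x = (\<Sum>i=1..n. \<Sum>j=1..n. dmat (diffop_mult (a i j) (basis (0, ell j))) i j)
      + Poly_Mapping.single Kappa c"
    unfolding gl_hat_sub_def by blast
  then show "x \<in> gl_hat n"
    unfolding gl_hat_def mem_Collect_eq
    by (intro exI[of _ "\<lambda>i j. diffop_mult (a i j) (basis (0, ell j))"] exI[of _ c]) simp
qed

lemma ffact_gbinomial: "ffact a r = fact r * (a gchoose r)"
  by (simp add: ffact_def gbinomial_prod_rev atLeast0LessThan)

lemma ffact_add: "ffact a (p + q) = ffact a p * ffact (a - of_nat p) q"
  by (induction q) (simp_all add: ffact_def algebra_simps)

text \<open>The multiplication of basis elements is composition of operators: \<open>t\<^sup>m \<partial>\<^sup>r\<close> maps \<open>t\<^sup>a\<close> to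
  \<open>\<langle>a\<rangle>\<^sub>r t\<^bsup>a+m-r\<^esup>\<close>.\<close>

lemma ffact_compose:
  "(\<Sum>k\<le>r1. of_nat (r1 choose k) * ffact m k * ffact a (r1 + r2 - k))
     = ffact a r2 * ffact (a - of_nat r2 + m) r1"
proof -
  have "of_nat (r1 choose k) * ffact m k * ffact a (r1 + r2 - k)
          = ffact a r2 * fact r1 * ((m gchoose k) * ((a - of_nat r2) gchoose (r1 - k)))"
    if "k \<le> r1" for k
  proof -
    have "r1 + r2 - k = r2 + (r1 - k)" using that by simp
    then have "ffact a (r1 + r2 - k) = ffact a r2 * ffact (a - of_nat r2) (r1 - k)"
      by (simp only: ffact_add)
    moreover have "of_nat (r1 choose k) * ffact m k * ffact (a - of_nat r2) (r1 - k)
        = fact r1 * ((m gchoose k) * ((a - of_nat r2) gchoose (r1 - k)))"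
      using that by (simp add: ffact_gbinomial binomial_fact)
    ultimately show ?thesis by (simp add: mult_ac)
  qed
  then have "(\<Sum>k\<le>r1. of_nat (r1 choose k) * ffact m k * ffact a (r1 + r2 - k))
      = ffact a r2 * fact r1 * (\<Sum>k\<in>{0..r1}. (m gchoose k) * ((a - of_nat r2) gchoose (r1 - k)))"
    by (simp add: sum_distrib_left atMost_atLeast0)
  also have "\<dots> = ffact a r2 * ffact (a - of_nat r2 + m) r1"
    by (simp add: gbinomial_Vandermonde ffact_gbinomial[of _ r1] add.commute)
  finally show ?thesis .
qed

lemma fps_linear_mult_nth:
  fixes F :: "complex fps fps"
  shows "((fps_X - fps_const fps_X) * F) $ a $ b
    = (if a = 0 then 0 else F $ (a - 1) $ b) - (if b = 0 then 0 else F $ a $ (b - 1))"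
  by (simp add: left_diff_distrib)

lemma J_numerator_nth:
  "J_numerator \<iota> $ a $ b = (- \<iota> gchoose a) * (\<iota> gchoose b) - (if a = 0 \<and> b = 0 then 1 else 0)"
  by (simp add: J_numerator_def mult.commute)

lemma J_series_ex1: "\<exists>!F. (fps_X - fps_const fps_X) * F = J_numerator \<iota>"
proof -
  define g where "g a b = J_numerator \<iota> $ a $ b" for a b
  define F where "F = Abs_fps (\<lambda>a. Abs_fps (\<lambda>b. - (\<Sum>k\<le>a. g (a - k) (b + k + 1))))"
  have F_nth: "F $ a $ b = - (\<Sum>k\<le>a. g (a - k) (b + k + 1))" for a b
    by (simp add: F_def)
  have diag: "(\<Sum>k\<le>a. g (a - k) k) = 0" for a
  proof -
    have "(\<Sum>k\<le>a. (\<iota> gchoose k) * (- \<iota> gchoose (a - k))) = (0 gchoose a)"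
      using gbinomial_Vandermonde[of \<iota> "- \<iota>" a] by (simp add: atMost_atLeast0)
    moreover have "(\<Sum>k\<le>a. if a - k = 0 \<and> k = 0 then 1 else 0) = (if a = 0 then 1 else (0::complex))"
      by (cases "a = 0") (auto intro!: sum.neutral)
    moreover have "(0 gchoose a) = (if a = 0 then 1 else (0::complex))"
      by (cases a) simp_all
    ultimately show ?thesis
      unfolding g_def J_numerator_nth by (simp add: sum_subtractf mult.commute)
  qed
  have "(fps_X - fps_const fps_X) * F = J_numerator \<iota>"
  proof (intro fps_ext)
    fix a b
    have "((fps_X - fps_const fps_X) * F) $ a $ b = g a b"
    proof (cases a)
      case 0
      show ?thesis
        using diag[of 0] by (cases b) (simp_all add: fps_linear_mult_nth 0 F_nth)
    next
      case (Suc a')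
      have split: "(\<Sum>k\<le>a. g (a - k) (b + k)) = g a b + (\<Sum>k\<le>a'. g (a' - k) (b + k + 1))"
        unfolding Suc by (subst sum.atMost_Suc_shift) simp
      show ?thesis
      proof (cases b)
        case 0
        then show ?thesis
          using split diag[of a] by (simp add: fps_linear_mult_nth Suc F_nth add_eq_0_iff)
      next
        case (Suc b')
        have "F $ a $ b' = - (\<Sum>k\<le>a. g (a - k) (b + k))"
          by (simp add: F_nth Suc)
        then show ?thesis
          using split Suc \<open>a = Suc a'\<close> by (simp add: fps_linear_mult_nth F_nth)
      qed
    qed
    then show "((fps_X - fps_const fps_X) * F) $ a $ b = J_numerator \<iota> $ a $ b"
      by (simp add: g_def)
  qed
  moreover have "fps_X - fps_const fps_X \<noteq> (0 :: complex fps fps)"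
  proof
    assume "fps_X - fps_const fps_X = (0 :: complex fps fps)"
    then have "(fps_X - fps_const fps_X) $ 1 = (0 :: complex fps)"
      by simp
    then show False by simp
  qed
  ultimately show ?thesis
    by (metis mult_cancel_left)
qed

lemma J_series_eq: "(fps_X - fps_const fps_X) * J_series \<iota> = J_numerator \<iota>"
  unfolding J_series_def by (rule theI'[OF J_series_ex1])

lemma J_coeff_0: "J_coeff \<iota> 0 r = - (\<iota> gchoose (r + 1))"
proof -
  have "- (J_series \<iota> $ 0 $ r) = J_numerator \<iota> $ 0 $ (r + 1)"
    by (subst J_series_eq[symmetric]) (simp add: fps_linear_mult_nth)
  then show ?thesis
    by (simp add: J_coeff_def J_numerator_nth minus_equation_iff)
qed

end

theory Submission
  imports Defs "HOL-Computational_Algebra.Polynomial"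
begin

text \<open>Let \<open>U\<^sub>i\<^sub>j(a,b)\<close> be the matrix unit that takes the basis vector \<open>t\<^bsup>\<iota>+b\<^esup> e\<^sub>j\<close> to \<open>t\<^bsup>\<iota>+a\<^esup> e\<^sub>i\<close>;
  numbering these vectors by half-integers identifies it with one of the generators
  \<open>EE\<close>. Since \<open>t\<^sup>m \<partial>\<^sup>r\<close> takes \<open>t\<^sup>x\<close> to \<open>\<langle>x\<rangle>\<^sub>r t\<^bsup>x+m-r\<^esup>\<close>, the operator \<open>\<sigma>(t\<^sup>m \<partial>\<^sup>r E\<^sub>i\<^sub>j)\<close> is, up to a
  multiple of the central element, the sum of \<open>\<langle>\<iota>+b\<rangle>\<^sub>r U\<^sub>i\<^sub>j(m-r+b, b)\<close> over all integers \<open>b\<close>. The two Lie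
  algebras turn out to have the same submodules in the module, so that one of them acts
  irreducibly exactly when the other does.

  A matrix unit whose indices are both far out on the same side kills a given vector: this is so on the
  generating subspace, and the vectors with this property form a submodule
  (\<open>locally_truncated\<close>). Hence each of the above sums is finite on each vector, and submodules of the
  big algebra are submodules for \<open>\<sigma>\<close> (\<open>sigma_in_submodule\<close>).

  For the converse (\<open>sigma_submodule_is_submodule\<close>) fix a diagonal and a vector \<open>v\<close> of a submodule for
  \<open>\<sigma>\<close>. It contains the sums of \<open>\<langle>\<iota>+b\<rangle>\<^sub>r U\<^sub>i\<^sub>j(k+b, b) v\<close> for all \<open>r \<ge> \<ell>\<^sub>j\<close>, because \<open>m\<close> can be adjusted to
  \<open>r\<close>. As \<open>\<langle>\<iota>+b\<rangle>\<^bsub>\<ell>+q\<^esub> = \<langle>\<iota>+b\<rangle>\<^sub>\<ell> \<langle>\<iota>+b-\<ell>\<rangle>\<^sub>q\<close> and the numbers \<open>\<iota>+b-\<ell>\<close> are distinct, interpolation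
  (\<open>moments_in_subspace\<close>) isolates the single terms, and \<open>\<langle>\<iota>+b\<rangle>\<^sub>\<ell> \<noteq> 0\<close> because \<open>\<iota>\<close> is not an integer.

  Irreducibility of \<open>\<sigma>\<close> includes that \<open>\<sigma>\<close> is a representation (\<open>sigma_lie_module\<close>). Away from the
  centre this is the composition of differential operators. For the central terms, two
  operators on opposite diagonals contribute the finite sum \<open>cocycle\<close> from the Heaviside
  functions, and this has to agree with the binomial coefficient in the bracket of differential operators
  corrected by the constants in \<open>\<sigma>\<close> (\<open>cocycle_ffact\<close>). Both sides are polynomials in \<open>\<iota>\<close> with the
  same difference under \<open>\<iota> \<mapsto> \<iota> + 1\<close>, and at \<open>\<iota> = 0\<close> they agree by a convolution of binomial
  coefficients.\<close>

section \<open>Falling factorials\<close>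

text \<open>Coefficientwise this is \<open>X\<^sup>p (1 - X)\<^bsup>-p-1\<^esup> \<cdot> (1 - X)\<^bsup>-q-1\<^esup> = X\<^sup>p (1 - X)\<^bsup>-p-q-2\<^esup>\<close>. The induction
  uses Pascal's rule in the second factor, which lowers \<open>q\<close> in one part and \<open>d\<close> in the other.\<close>

lemma sum_choose_convolution:
  "(\<Sum>y<d. (y choose p) * ((q + (d - Suc y)) choose q)) = (d + q) choose (p + q + 1)"
proof (induction q arbitrary: d)
  case 0
  show ?case
    by (induction d) simp_all
next
  case (Suc q)
  note convolution_q = Suc.IH
  show ?case
  proof (induction d)
    case 0
    show ?case by simp
  next
    case (Suc d)
    have "(\<Sum>y<Suc d. (y choose p) * ((Suc q + (Suc d - Suc y)) choose Suc q))
        = (\<Sum>y<Suc d. (y choose p) * ((q + (Suc d - Suc y)) choose q)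
            + (y choose p) * ((q + (Suc d - Suc y)) choose Suc q))"
      by (intro sum.cong) (simp_all add: algebra_simps)
    also have "\<dots> = (Suc d + q choose (p + q + 1))
        + (\<Sum>y<Suc d. (y choose p) * ((q + (Suc d - Suc y)) choose Suc q))"
      by (simp only: sum.distrib convolution_q)
    also have "(\<Sum>y<Suc d. (y choose p) * ((q + (Suc d - Suc y)) choose Suc q))
        = (\<Sum>y<d. (y choose p) * ((Suc q + (d - Suc y)) choose Suc q))"
    proof -
      have "q + (Suc d - Suc y) = Suc q + (d - Suc y)" if "y < d" for y
        using that by simp
      then show ?thesis by simp
    qed
    also have "\<dots> = d + Suc q choose (p + Suc q + 1)"
      by (rule Suc.IH)
    finally show ?case by simp
  qed
qed

lemma ffact_Suc: "ffact a (Suc r) = ffact a r * (a - of_nat r)"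
  by (simp add: ffact_def)

lemma ffact_Suc_left: "ffact (a + 1) (Suc r) = (a + 1) * ffact a r"
proof -
  have "ffact (a + 1) (1 + r) = ffact (a + 1) 1 * ffact (a + 1 - of_nat 1) r"
    by (rule ffact_add)
  then show ?thesis by (simp add: ffact_def)
qed

lemma ffact_antidifference:
  "ffact (x + 1) (Suc r) / of_nat (Suc r) - ffact x (Suc r) / of_nat (Suc r) = ffact x r"
proof -
  have "ffact (x + 1) (Suc r) - ffact x (Suc r) = of_nat (Suc r) * ffact x r"
    by (simp only: ffact_Suc_left ffact_Suc[of x]) (simp add: algebra_simps)
  then show ?thesis by (simp add: diff_divide_distrib[symmetric] del: of_nat_Suc)
qed

lemma ffact_ne_0:
  assumes "x \<notin> \<int>"
  shows "ffact x r \<noteq> 0"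
proof
  assume "ffact x r = 0"
  then obtain k where "x = of_nat k" by (auto simp: ffact_def)
  with assms show False by simp
qed

text \<open>The shape in which the convolution occurs at \<open>\<iota> = 0\<close>: the second argument is negative, and
  negating the upper index of the binomial coefficient produces the sign.\<close>

lemma sum_ffact_convolution:
  "(\<Sum>y<d. ffact (of_nat y) p * ffact (of_nat y - of_nat d) q)
     = (- 1) ^ q * fact p * fact q * of_nat ((d + q) choose (p + q + 1))"
proof -
  have summand: "ffact (of_nat y) p * ffact (of_nat y - of_nat d) q
      = (- 1) ^ q * fact p * fact q * of_nat ((y choose p) * ((q + (d - Suc y)) choose q))"
    if "y < d" for y
  proof -
    have "(of_nat y - of_nat d :: complex) gchoose q
        = (- 1) ^ q * ((of_nat q - (of_nat y - of_nat d) - 1) gchoose q)"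
      by (rule gbinomial_negated_upper)
    also have "of_nat q - (of_nat y - of_nat d) - 1 = (of_nat (q + (d - Suc y)) :: complex)"
      using that by (simp add: of_nat_diff algebra_simps)
    finally show ?thesis
      by (simp add: ffact_gbinomial binomial_gbinomial)
  qed
  have "(\<Sum>y<d. ffact (of_nat y) p * ffact (of_nat y - of_nat d) q)
      = (- 1) ^ q * fact p * fact q * of_nat (\<Sum>y<d. (y choose p) * ((q + (d - Suc y)) choose q))"
    by (simp add: summand sum_distrib_left)
  then show ?thesis by (simp only: sum_choose_convolution)
qed

section \<open>The central terms\<close>

definition polynomial_fun :: "(complex \<Rightarrow> complex) \<Rightarrow> bool" where
  "polynomial_fun f \<longleftrightarrow> (\<exists>p. f = poly p)"

lemma polynomial_fun_const: "polynomial_fun (\<lambda>x. c)"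
  unfolding polynomial_fun_def by (intro exI[of _ "[:c:]"]) auto

lemma polynomial_fun_shift: "polynomial_fun (\<lambda>x. x + c)"
  unfolding polynomial_fun_def by (intro exI[of _ "[:c, 1:]"]) (auto simp: add.commute)

lemma polynomial_fun_add:
  "polynomial_fun f \<Longrightarrow> polynomial_fun g \<Longrightarrow> polynomial_fun (\<lambda>x. f x + g x)"
  unfolding polynomial_fun_def by (auto simp: fun_eq_iff simp flip: poly_add)

lemma polynomial_fun_mult:
  "polynomial_fun f \<Longrightarrow> polynomial_fun g \<Longrightarrow> polynomial_fun (\<lambda>x. f x * g x)"
  unfolding polynomial_fun_def by (auto simp: fun_eq_iff simp flip: poly_mult)

lemma polynomial_fun_diff:
  "polynomial_fun f \<Longrightarrow> polynomial_fun g \<Longrightarrow> polynomial_fun (\<lambda>x. f x - g x)"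
  unfolding polynomial_fun_def by (auto simp: fun_eq_iff simp flip: poly_diff)

lemma polynomial_fun_sum:
  "(\<And>a. a \<in> A \<Longrightarrow> polynomial_fun (f a)) \<Longrightarrow> polynomial_fun (\<lambda>x. \<Sum>a\<in>A. f a x)"
  by (induction A rule: infinite_finite_induct)
     (auto intro: polynomial_fun_const polynomial_fun_add)

lemma polynomial_fun_ffact: "polynomial_fun (\<lambda>x. ffact (x + c) r)"
proof (induction r)
  case 0
  show ?case by (simp add: ffact_def polynomial_fun_const)
next
  case (Suc r)
  have "polynomial_fun (\<lambda>x. ffact (x + c) r * (x + (c - of_nat r)))"
    by (intro polynomial_fun_mult Suc polynomial_fun_shift)
  then show ?case by (simp add: ffact_Suc algebra_simps)
qed

text \<open>Such a function vanishes at all natural numbers, hence has infinitely many roots.\<close>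

lemma periodic_polynomial_fun_eq_0:
  assumes "polynomial_fun f" and "\<And>x. f (x + 1) = f x" and "f 0 = 0"
  shows "f x = 0"
proof -
  obtain p where p: "f = poly p"
    using assms(1) by (auto simp: polynomial_fun_def)
  have "f (of_nat k) = 0" for k
    by (induction k) (simp_all add: assms add.commute[of 1])
  then have "range of_nat \<subseteq> {x. poly p x = 0}"
    by (auto simp: p)
  moreover have "infinite (range (of_nat :: nat \<Rightarrow> complex))"
    by (simp add: range_inj_infinite inj_of_nat)
  ultimately have "p = 0"
    using poly_roots_finite finite_subset by blast
  then show ?thesis by (simp add: p)
qed

text \<open>For \<open>f\<close> the product of the coefficients of two operators on the \<open>k\<close>-th and the \<open>(-k)\<close>-th diagonal, this
  is the central term of their commutator: only the indices \<open>a\<close> for which \<open>a\<close> and \<open>k + a\<close> have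
  different signs contribute.\<close>

definition cocycle :: "int \<Rightarrow> (int \<Rightarrow> complex) \<Rightarrow> complex" where
  "cocycle k f = (\<Sum>a\<in>{- k..<0}. f a) - (\<Sum>a\<in>{0..<- k}. f a)"

lemma cocycle_eq_if:
  "cocycle k f = (if k \<le> 0 then - (\<Sum>y<nat (- k). f (int y)) else (\<Sum>y<nat k. f (int y - k)))"
proof (cases "k \<le> 0")
  case True
  have "(\<Sum>a\<in>{0..<- k}. f a) = (\<Sum>y<nat (- k). f (int y))"
    by (rule sum.reindex_bij_witness[of _ int nat]) (use True in auto)
  then show ?thesis using True by (simp add: cocycle_def)
next
  case False
  have "(\<Sum>a\<in>{- k..<0}. f a) = (\<Sum>y<nat k. f (int y - k))"
    by (rule sum.reindex_bij_witness[of _ "\<lambda>y. int y - k" "\<lambda>a. nat (a + k)"]) (use False in auto)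
  then show ?thesis using False by (simp add: cocycle_def)
qed

lemma cocycle_eq_sum:
  assumes "\<bar>k\<bar> \<le> N"
  shows "(\<Sum>a\<in>{- N..N}. f a * ((if k + a \<ge> 0 then 1 else 0) - (if a \<ge> 0 then 1 else 0))) = cocycle k f"
proof -
  have "f a * ((if k + a \<ge> 0 then 1 else 0) - (if a \<ge> 0 then 1 else 0))
      = (if a \<in> {- k..<0} then f a else 0) - (if a \<in> {0..<- k} then f a else 0)" for a
    by auto
  moreover have "(\<Sum>a\<in>{- N..N}. if a \<in> {- k..<0} then f a else 0) = (\<Sum>a\<in>{- k..<0}. f a)"
    "(\<Sum>a\<in>{- N..N}. if a \<in> {0..<- k} then f a else 0) = (\<Sum>a\<in>{0..<- k}. f a)"
    using assms by (intro sum.mono_neutral_cong_right; auto)+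
  ultimately show ?thesis
    by (simp only: cocycle_def sum_subtractf)
qed

text \<open>Since \<open>\<langle>x\<rangle>\<^bsub>r+1\<^esub> / (r + 1)\<close> has the difference \<open>\<langle>x\<rangle>\<^sub>r\<close>, this is the polynomial that vanishes at \<open>0\<close> and whose
  difference is the coefficient by which \<open>\<partial>\<^sup>p \<cdot> t\<^sup>m \<partial>\<^sup>q\<close> multiplies \<open>t\<^sup>x\<close>. Its negative at \<open>\<iota>\<close> is the
  central constant which \<open>\<sigma>\<close> attaches to a product of degree \<open>0\<close>.\<close>

definition ffact_trace :: "int \<Rightarrow> nat \<Rightarrow> nat \<Rightarrow> complex \<Rightarrow> complex" where
  "ffact_trace m p q x =
     (\<Sum>j\<le>p. of_nat (p choose j) * ffact (of_int m) j
        * (ffact x (Suc (p + q - j)) / of_nat (Suc (p + q - j))))"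

lemma polynomial_fun_ffact_trace: "polynomial_fun (ffact_trace m p q)"
proof -
  have "polynomial_fun (\<lambda>x. (of_nat (p choose j) * ffact (of_int m) j / of_nat (Suc (p + q - j)))
      * ffact (x + 0) (Suc (p + q - j)))" for j
    by (intro polynomial_fun_mult polynomial_fun_const polynomial_fun_ffact)
  then have "polynomial_fun (\<lambda>x. \<Sum>j\<le>p. (of_nat (p choose j) * ffact (of_int m) j / of_nat (Suc (p + q - j)))
      * ffact (x + 0) (Suc (p + q - j)))"
    by (intro polynomial_fun_sum)
  then show ?thesis
    unfolding ffact_trace_def by (simp add: field_simps del: of_nat_Suc)
qed

lemma ffact_trace_difference:
  "ffact_trace m p q (x + 1) - ffact_trace m p q x = ffact x q * ffact (x - of_nat q + of_int m) p"
proof -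
  have "ffact_trace m p q (x + 1) - ffact_trace m p q x
      = (\<Sum>j\<le>p. of_nat (p choose j) * ffact (of_int m) j * ffact x (p + q - j))"
    unfolding ffact_trace_def
    by (simp only: sum_subtractf[symmetric] right_diff_distrib[symmetric] ffact_antidifference)
  then show ?thesis
    by (simp only: ffact_compose)
qed

lemma ffact_trace_0: "ffact_trace m p q 0 = 0"
  by (simp add: ffact_trace_def ffact_gbinomial gbinomial_0)

text \<open>Both sides are polynomials in \<open>x\<close>, and both change by \<open>P(x) - P(x - k)\<close> when \<open>x\<close> is increased by
  \<open>1\<close>, where \<open>P(x) = \<langle>x\<rangle>\<^bsub>r1\<^esub> \<langle>x+k\<rangle>\<^bsub>r2\<^esub>\<close>: the left side by telescoping, the right side
  by the choice of \<open>ffact_trace\<close>. At \<open>x = 0\<close> the traces vanish and the sum is a convolution.\<close>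

lemma cocycle_ffact:
  fixes x :: complex
  assumes "m1 + m2 = int (r1 + r2)"
  defines "k \<equiv> m1 - int r1"
  shows "cocycle k (\<lambda>a. ffact (x + of_int a) r1 * ffact (x + of_int (k + a)) r2)
    = ffact_trace m1 r2 r1 x - ffact_trace m2 r1 r2 x
      + (- 1) ^ r1 * fact r1 * fact r2 * (of_int m1 gchoose (r1 + r2 + 1))"
proof -
  define P where "P x = ffact x r1 * ffact (x + of_int k) r2" for x :: complex
  have P: "ffact (x + of_int a) r1 * ffact (x + of_int (k + a)) r2 = P (x + of_int a)" for a x
    by (simp add: P_def algebra_simps)
  define S where "S x = cocycle k (\<lambda>a. P (x + of_int a))" for x
  define c :: complex where "c = (- 1) ^ r1 * fact r1 * fact r2 * (of_int m1 gchoose (r1 + r2 + 1))"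
  define Q where "Q x = S x - (ffact_trace m1 r2 r1 x - ffact_trace m2 r1 r2 x + c)" for x
  have m2: "of_int m2 = (of_nat r2 - of_int k :: complex)"
  proof -
    have "m2 = int r2 - k" using assms by simp
    then show ?thesis by simp
  qed
  have S_diff: "S (x + 1) - S x = P x - P (x - of_int k)" for x
  proof (cases "k \<le> 0")
    case True
    have "S (x + 1) - S x = - (\<Sum>y<nat (- k). P (x + of_nat (Suc y)) - P (x + of_nat y))"
      using True by (simp add: S_def cocycle_eq_if sum_subtractf algebra_simps)
    also have "\<dots> = P x - P (x + of_nat (nat (- k)))"
      by (subst sum_lessThan_telescope) simp
    finally show ?thesis using True by simp
  next
    case False
    have "S (x + 1) - S x = (\<Sum>y<nat k. P (x - of_int k + of_nat (Suc y)) - P (x - of_int k + of_nat y))"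
      using False by (simp add: S_def cocycle_eq_if sum_subtractf algebra_simps)
    also have "\<dots> = P (x - of_int k + of_nat (nat k)) - P (x - of_int k)"
      by (subst sum_lessThan_telescope) simp
    finally show ?thesis using False by simp
  qed
  have "polynomial_fun (\<lambda>x. P (x + z))" for z
    unfolding P_def using polynomial_fun_mult[OF polynomial_fun_ffact[of z] polynomial_fun_ffact[of "z + of_int k"]]
    by (simp add: add.assoc)
  then have P_sum: "polynomial_fun (\<lambda>x. \<Sum>y\<in>A. P (x + g y))" for A and g :: "nat \<Rightarrow> complex"
    by (intro polynomial_fun_sum)
  have "polynomial_fun S"
    unfolding S_def cocycle_eq_if
    using P_sum polynomial_fun_diff[OF polynomial_fun_const[of 0] P_sum]
    by (cases "k \<le> 0") simp_all
  then have "polynomial_fun Q"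
    unfolding Q_def
    by (intro polynomial_fun_diff polynomial_fun_add polynomial_fun_const polynomial_fun_ffact_trace)
  moreover have "Q (x + 1) = Q x" for x
  proof -
    have "Q (x + 1) - Q x = (S (x + 1) - S x)
        - (ffact_trace m1 r2 r1 (x + 1) - ffact_trace m1 r2 r1 x)
        + (ffact_trace m2 r1 r2 (x + 1) - ffact_trace m2 r1 r2 x)"
      by (simp add: Q_def)
    also have "\<dots> = 0"
      unfolding S_diff ffact_trace_difference P_def
      by (simp add: m2) (simp add: k_def algebra_simps)
    finally show ?thesis by simp
  qed
  moreover have "Q 0 = 0"
  proof -
    have "S 0 = c"
    proof (cases "k \<le> 0")
      case True
      define d where "d = nat (- k)"
      have k: "k = - int d" using True by (simp add: d_def)
      have "S 0 = - ((- 1) ^ r2 * fact r1 * fact r2 * of_nat ((d + r2) choose (r1 + r2 + 1)))"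
        using sum_ffact_convolution[of r1 d r2] by (simp add: S_def cocycle_eq_if P_def k)
      also have "of_nat ((d + r2) choose (r1 + r2 + 1))
          = (- 1) ^ (r1 + r2 + 1) * ((of_int m1 :: complex) gchoose (r1 + r2 + 1))"
      proof -
        have "m1 = int r1 - int d" using k by (simp add: k_def)
        then have upper: "of_nat (r1 + r2 + 1) - of_int m1 - 1 = (of_nat (d + r2) :: complex)" by simp
        show ?thesis
          using gbinomial_negated_upper[of "of_int m1 :: complex" "r1 + r2 + 1"]
          unfolding upper by (simp add: binomial_gbinomial)
      qed
      finally show ?thesis
        by (simp add: c_def power_add flip: power_mult_distrib)
    next
      case False
      define d where "d = nat k"
      have k: "k = int d" using False by (simp add: d_def)
      \<comment> \<open>Here the binomial coefficient has a natural upper index, and the roles of \<open>r1\<close> and \<open>r2\<close>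
        in the convolution are exchanged.\<close>
      then have "m1 = int (d + r1)" by (simp add: k_def)
      then have "of_int m1 = (of_nat (d + r1) :: complex)" by simp
      then show ?thesis
        using sum_ffact_convolution[of r2 d r1] False
        by (simp add: S_def cocycle_eq_if P_def k c_def binomial_gbinomial mult.commute add.commute)
    qed
    then show ?thesis by (simp add: Q_def ffact_trace_0)
  qed
  ultimately have "Q x = 0"
    by (rule periodic_polynomial_fun_eq_0)
  then show ?thesis
    unfolding P by (simp add: Q_def S_def c_def)
qed

section \<open>Linear extension\<close>

lemma lin_ext_superset:
  assumes "vector_space s" and "finite A" and "Poly_Mapping.keys x \<subseteq> A"
  shows "lin_ext s f x = (\<Sum>b\<in>A. s (Poly_Mapping.lookup x b) (f b))"
proof -
  interpret vector_space s by fact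
  show ?thesis
    unfolding lin_ext_def using assms(2,3)
    by (intro sum.mono_neutral_left) (auto simp: in_keys_iff)
qed

lemma linear_lin_ext:
  assumes "vector_space s"
  shows "Vector_Spaces.linear fscale s (lin_ext s f)"
proof -
  interpret vector_space s by fact
  interpret fs: vector_space "fscale :: complex \<Rightarrow> ('b \<Rightarrow>\<^sub>0 complex) \<Rightarrow> _" by (rule vector_space_fscale)
  show ?thesis
  proof unfold_locales
    fix x y :: "'b \<Rightarrow>\<^sub>0 complex" and c
    let ?A = "Poly_Mapping.keys x \<union> Poly_Mapping.keys y"
    have "Poly_Mapping.keys (x + y) \<subseteq> ?A"
      by (rule Poly_Mapping.keys_add)
    then show "lin_ext s f (x + y) = lin_ext s f x + lin_ext s f y"
      using lin_ext_superset[OF assms, of ?A]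
      by (simp add: lookup_add scale_left_distrib sum.distrib)
    have "Poly_Mapping.keys (fscale c x) \<subseteq> Poly_Mapping.keys x"
      by (auto simp: in_keys_iff lookup_fscale)
    then show "lin_ext s f (fscale c x) = s c (lin_ext s f x)"
      using lin_ext_superset[OF assms, of "Poly_Mapping.keys x"]
      by (simp add: lookup_fscale scale_sum_right)
  qed
qed

lemma lin_ext_single:
  assumes "vector_space s"
  shows "lin_ext s f (Poly_Mapping.single b c) = s c (f b)"
proof -
  interpret vector_space s by fact
  show ?thesis
    using lin_ext_superset[OF assms, of "{b}" "Poly_Mapping.single b c"] by simp
qed

lemma fscale_single: "fscale c (Poly_Mapping.single b z) = Poly_Mapping.single b (c * z)"
  by (rule poly_mapping_eqI) (simp add: lookup_fscale lookup_single when_def)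

lemma basis_expansion: "x = (\<Sum>b\<in>Poly_Mapping.keys x. fscale (Poly_Mapping.lookup x b) (basis b))"
  by (rule poly_mapping_eqI)
     (simp add: lookup_sum lookup_fscale lookup_single when_def in_keys_iff if_distrib[of "(*) _"]
       cong: if_cong)

lemma fscale_0_left: "fscale 0 x = 0"
  by (rule poly_mapping_eqI) (simp add: lookup_fscale)

lemma bilin_ext_basis: "bilin_ext B (basis a) (basis b) = B a b"
  by (simp add: bilin_ext_def lin_ext_single[OF vector_space_fscale]
      vector_space.vector_space_assms(4)[OF vector_space_fscale])

lemma dmat_sum_single:
  "dmat (\<Sum>k\<in>A. Poly_Mapping.single (p k) (c k)) i j
     = (\<Sum>k\<in>A. Poly_Mapping.single (case p k of (m, r) \<Rightarrow> TD m r i j) (c k))"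
proof -
  interpret Vector_Spaces.linear fscale fscale "\<lambda>a. dmat a i j :: hat_index \<Rightarrow>\<^sub>0 complex"
    unfolding dmat_def by (rule linear_lin_ext[OF vector_space_fscale])
  show ?thesis
    unfolding sum
    by (intro sum.cong)
       (auto simp: dmat_def lin_ext_single[OF vector_space_fscale] fscale_single split: prod.splits)
qed

lemma dmat_mult_basis:
  "dmat (diffop_mult (basis (m1, r1)) (basis (m2, r2))) i j
     = (\<Sum>k\<le>r1. Poly_Mapping.single (TD (m1 + m2 - int k) (r1 + r2 - k) i j)
                (of_nat (r1 choose k) * ffact (of_int m2) k))"
  by (simp add: diffop_mult_def bilin_ext_basis dmat_sum_single)

section \<open>Half-integer indices\<close>

text \<open>The half-integers, split into \<open>n\<close> residue classes \<open>i\<close>, each numbered by the integers \<open>a\<close>: the position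
  of \<open>t\<^bsup>\<iota>+a\<^esup> e\<^sub>i\<close>.\<close>

definition hidx :: "nat \<Rightarrow> nat \<Rightarrow> int \<Rightarrow> rat" where
  "hidx n i a = of_int (a * int n + int i) - 1 / 2"

lemma hidx_half_ints: "hidx n i a \<in> half_ints"
proof -
  have "hidx n i a = of_int (a * int n + int i - 1) + 1 / 2"
    by (simp add: hidx_def)
  then show ?thesis unfolding half_ints_def by blast
qed

lemma uminus_half_ints: "x \<in> half_ints \<Longrightarrow> - x \<in> half_ints"
proof -
  assume "x \<in> half_ints"
  then obtain k where "x = of_int k + 1 / 2" by (auto simp: half_ints_def)
  then have "- x = of_int (- k - 1) + 1 / 2" by simp
  then show ?thesis unfolding half_ints_def by blast
qed

lemma level_residue_unique:
  fixes a b :: int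
  assumes "i \<in> {1..n}" "j \<in> {1..n}" "a * int n + int i = b * int n + int j"
  shows "i = j \<and> a = b"
proof -
  have "(a * int n + (int i - 1)) div int n = a" "(b * int n + (int j - 1)) div int n = b"
    using assms(1,2) by auto
  moreover have "a * int n + (int i - 1) = b * int n + (int j - 1)"
    using assms(3) by simp
  ultimately have "a = b" by simp
  with assms(3) show ?thesis by simp
qed

lemma hidx_eq_iff:
  assumes "i \<in> {1..n}" "j \<in> {1..n}"
  shows "hidx n i a = hidx n j b \<longleftrightarrow> i = j \<and> a = b"
proof
  assume "hidx n i a = hidx n j b"
  then have "(of_int (a * int n + int i) :: rat) = of_int (b * int n + int j)"
    by (simp add: hidx_def)
  then have "a * int n + int i = b * int n + int j"
    by (simp only: of_int_eq_iff)
  then show "i = j \<and> a = b" by (rule level_residue_unique[OF assms])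
qed simp

lemma hidx_greater:
  assumes "i \<in> {1..n}" "a \<ge> int m"
  shows "hidx n i a > of_nat m"
proof -
  have "a * 1 \<le> a * int n"
    using assms by (intro mult_left_mono) auto
  then have "int m + 1 \<le> a * int n + int i"
    using assms by simp
  then have "(of_int (int m + 1) :: rat) \<le> of_int (a * int n + int i)"
    by (simp only: of_int_le_iff)
  then show ?thesis by (simp add: hidx_def)
qed

lemma hidx_less:
  assumes "i \<in> {1..n}" "a < - int m"
  shows "hidx n i a < - of_nat m"
proof -
  have "(a + 1) * int n \<le> (a + 1) * 1"
    using assms by (intro mult_left_mono_neg) auto
  then have "a * int n + int i \<le> - int m"
    using assms by (simp add: algebra_simps)
  then have "(of_int (a * int n + int i) :: rat) \<le> of_int (- int m)"
    by (simp only: of_int_le_iff)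
  then show ?thesis by (simp add: hidx_def)
qed

lemma heavi_hidx:
  assumes "i \<in> {1..n}"
  shows "heavi (hidx n i a) = (if a \<ge> 0 then 1 else 0)"
    and "heavi (- hidx n i a) = (if a \<ge> 0 then 0 else 1)"
  using hidx_greater[OF assms, of 0 a] hidx_less[OF assms, of a 0]
  by (cases "a \<ge> 0"; simp add: heavi_def)+

lemma half_ints_hidx:
  assumes "n \<ge> 1" "x \<in> half_ints"
  obtains i a where "i \<in> {1..n}" "x = hidx n i a"
proof -
  obtain k where k: "x = of_int k + 1 / 2" using assms(2) by (auto simp: half_ints_def)
  define i where "i = nat (k mod int n) + 1"
  have i: "int i = k mod int n + 1" using assms(1) by (simp add: i_def)
  have "k mod int n < int n" using assms(1) by simp
  then have "1 \<le> int i" "int i \<le> int n" using i assms(1) pos_mod_bound[of "int n" k] pos_mod_sign[of "int n" k] by linarith+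
  have quotient: "k div int n * int n + int i = k + 1"
    by (simp add: i)
  have "i \<in> {1..n}" using \<open>1 \<le> int i\<close> \<open>int i \<le> int n\<close> by simp
  moreover have "x = hidx n i (k div int n)"
    using quotient by (simp only: hidx_def k)
  ultimately show ?thesis by (rule that)
qed

section \<open>Interpolation by falling factorials\<close>

text \<open>The identity \<open>(x - c) \<langle>x\<rangle>\<^sub>q = \<langle>x\<rangle>\<^bsub>q+1\<^esub> + (q - c) \<langle>x\<rangle>\<^sub>q\<close> shows that the hypothesis on the moments
  passes from the vectors \<open>w\<^sub>b\<close> to \<open>(x\<^sub>b - c) w\<^sub>b\<close>. With \<open>c\<close> one of the points, that point drops out, which
  gives an induction on \<open>F\<close>; the zeroth moment then yields the vector at the point removed.\<close>

lemma moments_in_subspace: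
  fixes s :: "complex \<Rightarrow> 'v::ab_group_add \<Rightarrow> 'v"
  assumes "vector_space s" and "module.subspace s N" and "finite F" and "inj_on x F"
    and "\<And>q. (\<Sum>b\<in>F. s (ffact (x b) q) (w b)) \<in> N" and "b \<in> F"
  shows "w b \<in> N"
proof -
  interpret vector_space s by fact
  show ?thesis
    using assms(3-)
  proof (induction F arbitrary: w b rule: finite_induct)
    case empty
    then show ?case by simp
  next
    case (insert c F)
    note moments = insert.prems(2)
    have "s (x b - x c) (w b) \<in> N" if "b \<in> F" for b
    proof (rule insert.IH[OF _ _ that])
      show "inj_on x F" using insert.prems(1) by simp
      fix q
      have "(\<Sum>b\<in>F. s (ffact (x b) q) (s (x b - x c) (w b)))
          = (\<Sum>b\<in>insert c F. s (ffact (x b) q * (x b - x c)) (w b))"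
        using insert.hyps by simp
      also have "\<dots> = (\<Sum>b\<in>insert c F. s (ffact (x b) (Suc q)) (w b))
          + s (of_nat q - x c) (\<Sum>b\<in>insert c F. s (ffact (x b) q) (w b))"
        unfolding scale_sum_right sum.distrib[symmetric]
        by (intro sum.cong refl) (simp add: ffact_Suc algebra_simps flip: scale_left_distrib)
      also have "\<dots> \<in> N"
        by (intro subspace_add subspace_scale assms(2) moments)
      finally show "(\<Sum>b\<in>F. s (ffact (x b) q) (s (x b - x c) (w b))) \<in> N" .
    qed
    then have F: "w b \<in> N" if "b \<in> F" for b
    proof -
      have "x b - x c \<noteq> 0"
        using insert.prems(1) insert.hyps(2) that by (auto simp: inj_on_def)
      then have "w b = s (inverse (x b - x c)) (s (x b - x c) (w b))" by simp
      then show ?thesis using that \<open>\<And>b. b \<in> F \<Longrightarrow> s (x b - x c) (w b) \<in> N\<close>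
        by (metis subspace_scale assms(2))
    qed
    have "w c = (\<Sum>b\<in>insert c F. s (ffact (x b) 0) (w b)) - (\<Sum>b\<in>F. w b)"
      using insert.hyps by (simp add: ffact_def)
    also have "\<dots> \<in> N"
      by (intro subspace_diff subspace_sum assms(2) moments F)
    finally show ?case using F insert.prems(3) by auto
  qed
qed

section \<open>Modules over the infinite matrices\<close>

lemma gl_tilde_0: "0 \<in> gl_tilde"
  by (simp add: gl_tilde_def)

lemma gl_tilde_add: "x \<in> gl_tilde \<Longrightarrow> y \<in> gl_tilde \<Longrightarrow> x + y \<in> gl_tilde"
  unfolding gl_tilde_def using Poly_Mapping.keys_add[of x y] by blast

lemma gl_tilde_fscale: "x \<in> gl_tilde \<Longrightarrow> fscale c x \<in> gl_tilde"
  unfolding gl_tilde_def by (auto simp: in_keys_iff lookup_fscale subset_iff)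

lemma gl_tilde_diff: "x \<in> gl_tilde \<Longrightarrow> y \<in> gl_tilde \<Longrightarrow> x - y \<in> gl_tilde"
  unfolding gl_tilde_def using Poly_Mapping.keys_diff[of x y] by blast

lemma gl_tilde_EE: "l \<in> half_ints \<Longrightarrow> k \<in> half_ints \<Longrightarrow> Poly_Mapping.single (EE l k) c \<in> gl_tilde"
  by (auto simp: gl_tilde_def)

lemma gl_tilde_Kappa0: "Poly_Mapping.single Kappa0 c \<in> gl_tilde"
  by (auto simp: gl_tilde_def)

lemma gl_tilde_bracket_basis: "gl_tilde_bracket (basis a) (basis b) = gl_tilde_basis_bracket a b"
  by (simp add: gl_tilde_bracket_def bilin_ext_basis)

lemma
  assumes "l1 \<in> half_ints" "l2 \<in> half_ints" "l1 > of_nat m" "l2 > of_nat m"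
  shows gl_tilde_trunc_pos: "basis (EE l1 (- l2)) \<in> gl_tilde_trunc m"
    and gl_tilde_trunc_neg: "basis (EE (- l1) l2) \<in> gl_tilde_trunc m"
proof -
  interpret fs: vector_space "fscale :: complex \<Rightarrow> (tilde_index \<Rightarrow>\<^sub>0 complex) \<Rightarrow> _"
    by (rule vector_space_fscale)
  show "basis (EE l1 (- l2)) \<in> gl_tilde_trunc m"
    unfolding gl_tilde_trunc_def using assms by (intro fs.span_base) blast
  show "basis (EE (- l1) l2) \<in> gl_tilde_trunc m"
    unfolding gl_tilde_trunc_def using assms by (intro fs.span_base) blast
qed

locale gl_tilde_module = lie_module gl_tilde gl_tilde_bracket s act
  for s :: "complex \<Rightarrow> 'v::ab_group_add \<Rightarrow> 'v" and act
begin

lemma linear_act: "x \<in> gl_tilde \<Longrightarrow> Vector_Spaces.linear s s (act x)"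
  by unfold_locales (simp_all add: act_add_right act_scale_right)

lemma act_0_left: "act 0 v = 0"
  using act_scale_left[OF gl_tilde_0, of 0 v] by (simp add: fscale_0_left)

lemma act_0_right: "x \<in> gl_tilde \<Longrightarrow> act x 0 = 0"
  using act_scale_right[of x 0 0] by simp

lemma act_diff_left: "x \<in> gl_tilde \<Longrightarrow> y \<in> gl_tilde \<Longrightarrow> act (x - y) v = act x v - act y v"
  using act_add_left[of "x - y" y v] by (simp add: gl_tilde_diff)

lemma act_sum_left:
  "(\<And>a. a \<in> A \<Longrightarrow> x a \<in> gl_tilde) \<Longrightarrow> (\<Sum>a\<in>A. x a) \<in> gl_tilde \<and> act (\<Sum>a\<in>A. x a) v = (\<Sum>a\<in>A. act (x a) v)"
  by (induction A rule: infinite_finite_induct)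
     (simp_all add: gl_tilde_0 gl_tilde_add act_0_left act_add_left)

lemma act_basis_expansion:
  assumes "x \<in> gl_tilde"
  shows "act x v = (\<Sum>b\<in>Poly_Mapping.keys x. s (Poly_Mapping.lookup x b) (act (basis b) v))"
proof -
  have mem: "basis b \<in> gl_tilde" if "b \<in> Poly_Mapping.keys x" for b
    using assms that by (auto simp: gl_tilde_def)
  have "act x v = act (\<Sum>b\<in>Poly_Mapping.keys x. fscale (Poly_Mapping.lookup x b) (basis b)) v"
    using basis_expansion[of x] by simp
  also have "\<dots> = (\<Sum>b\<in>Poly_Mapping.keys x. act (fscale (Poly_Mapping.lookup x b) (basis b)) v)"
    using act_sum_left[of "Poly_Mapping.keys x" "\<lambda>b. fscale (Poly_Mapping.lookup x b) (basis b)" v]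
      mem gl_tilde_fscale by blast
  also have "\<dots> = (\<Sum>b\<in>Poly_Mapping.keys x. s (Poly_Mapping.lookup x b) (act (basis b) v))"
    by (intro sum.cong refl act_scale_left mem)
  finally show ?thesis .
qed

lemma act_single_Kappa0: "act (Poly_Mapping.single Kappa0 c) v = s c (act (basis Kappa0) v)"
  using act_scale_left[OF gl_tilde_Kappa0, of c 1 v] by (simp add: fscale_single)

lemma act_Kappa0_commute:
  assumes "x \<in> gl_tilde"
  shows "act x (act (basis Kappa0) v) = act (basis Kappa0) (act x v)"
proof -
  interpret fs: vector_space "fscale :: complex \<Rightarrow> (tilde_index \<Rightarrow>\<^sub>0 complex) \<Rightarrow> _"
    by (rule vector_space_fscale)
  have "gl_tilde_bracket (basis Kappa0) x = 0"
    by (simp add: gl_tilde_bracket_def bilin_ext_def lin_ext_single[OF vector_space_fscale] lin_ext_def)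
  then show ?thesis
    using act_bracket[OF gl_tilde_Kappa0 assms, of 1 v] by (simp add: act_0_left)
qed

text \<open>Far enough out, a matrix unit commutes with any given one, because no indices match. So the vectors
  killed by all matrix units far out form a submodule, and this contains the generating
  subspace.\<close>

lemma locally_truncated:
  assumes M0: "lie_submodule gl_tilde s act hull M0 = UNIV"
    and killed: "\<forall>x\<in>gl_tilde_trunc m. \<forall>v\<in>M0. act x v = 0"
  obtains m' where "\<And>l1 l2. l1 \<in> half_ints \<Longrightarrow> l2 \<in> half_ints \<Longrightarrow>
      l1 > of_nat m' \<and> l2 < - of_nat m' \<or> l1 < - of_nat m' \<and> l2 > of_nat m' \<Longrightarrow> act (basis (EE l1 l2)) v = 0"
proof -
  define far :: "nat \<Rightarrow> rat \<Rightarrow> rat \<Rightarrow> bool" where "far m l1 l2 \<longleftrightarrow> l1 \<in> half_ints \<and> l2 \<in> half_ints \<and>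
      (l1 > of_nat m \<and> l2 < - of_nat m \<or> l1 < - of_nat m \<and> l2 > of_nat m)" for m l1 l2
  define N where "N = {v. \<exists>m. \<forall>l1 l2. far m l1 l2 \<longrightarrow> act (basis (EE l1 l2)) v = 0}"
  have far_mono: "far m' l1 l2 \<Longrightarrow> m \<le> m' \<Longrightarrow> far m l1 l2" for m m' l1 l2
  proof -
    assume "far m' l1 l2" "m \<le> m'"
    then have "(of_nat m :: rat) \<le> of_nat m'" by simp
    with \<open>far m' l1 l2\<close> show ?thesis by (auto simp: far_def)
  qed
  have far_mem: "far m l1 l2 \<Longrightarrow> basis (EE l1 l2) \<in> gl_tilde" for m l1 l2
    by (simp add: far_def gl_tilde_EE)
  have act_N: "act (basis b) v \<in> N" if v: "v \<in> N" and b: "basis b \<in> gl_tilde" for b v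
  proof (cases b)
    case (EE k1 k2)
    have k: "k1 \<in> half_ints" "k2 \<in> half_ints"
      using b by (auto simp: gl_tilde_def EE)
    obtain m where m: "\<And>l1 l2. far m l1 l2 \<Longrightarrow> act (basis (EE l1 l2)) v = 0"
      using v by (auto simp: N_def)
    obtain m' :: nat where m': "max \<bar>k1\<bar> \<bar>k2\<bar> \<le> of_nat m'"
      using real_arch_simple[of "max \<bar>k1\<bar> \<bar>k2\<bar>"] by blast
    have "act (basis (EE l1 l2)) (act (basis b) v) = 0" if far: "far (max m m') l1 l2" for l1 l2
    proof -
      have "far m' l1 l2" "far m l1 l2" using far_mono[OF far] by simp_all
      then have "l2 + k1 \<noteq> 0" "k2 + l1 \<noteq> 0" using m' by (auto simp: far_def)
      then have "gl_tilde_bracket (basis (EE l1 l2)) (basis b) = 0"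
        by (simp add: gl_tilde_bracket_basis EE add.commute)
      then have "act (basis (EE l1 l2)) (act (basis b) v) = act (basis b) (act (basis (EE l1 l2)) v)"
        using act_bracket[OF far_mem[OF far] b, of v] by (simp add: act_0_left)
      also have "\<dots> = act (basis b) 0" using m[OF \<open>far m l1 l2\<close>] by simp
      also have "\<dots> = 0"
        by (rule act_0_right[OF b])
      finally show ?thesis .
    qed
    then show ?thesis unfolding N_def by blast
  next
    case Kappa0
    obtain m where m: "\<And>l1 l2. far m l1 l2 \<Longrightarrow> act (basis (EE l1 l2)) v = 0"
      using v by (auto simp: N_def)
    then have "\<forall>l1 l2. far m l1 l2 \<longrightarrow> act (basis (EE l1 l2)) (act (basis b) v) = 0"
      by (simp add: Kappa0 act_Kappa0_commute[OF far_mem] act_0_right[OF gl_tilde_Kappa0])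
    then show ?thesis unfolding N_def by blast
  qed
  have "subspace N"
    unfolding subspace_def
  proof (intro conjI ballI allI)
    have "act (basis (EE l1 l2)) 0 = 0" if "far m l1 l2" for m l1 l2
      using act_scale_right[OF far_mem[OF that], of 0 0] by simp
    then show "0 \<in> N" unfolding N_def by blast
  next
    fix v w assume "v \<in> N" "w \<in> N"
    then obtain m m' where "\<And>l1 l2. far m l1 l2 \<Longrightarrow> act (basis (EE l1 l2)) v = 0"
      "\<And>l1 l2. far m' l1 l2 \<Longrightarrow> act (basis (EE l1 l2)) w = 0"
      by (auto simp: N_def)
    then have "\<forall>l1 l2. far (max m m') l1 l2 \<longrightarrow> act (basis (EE l1 l2)) (v + w) = 0"
      using far_mono[of "max m m'" _ _ m] far_mono[of "max m m'" _ _ m']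
      by (simp add: act_add_right[OF far_mem])
    then show "v + w \<in> N" unfolding N_def by blast
  next
    fix c v assume "v \<in> N"
    then show "s c v \<in> N"
      unfolding N_def using act_scale_right far_mem by fastforce
  qed
  moreover have "act x v \<in> N" if "x \<in> gl_tilde" "v \<in> N" for x v
  proof -
    have "basis b \<in> gl_tilde" if "b \<in> Poly_Mapping.keys x" for b
      using \<open>x \<in> gl_tilde\<close> that by (auto simp: gl_tilde_def)
    then show ?thesis
      unfolding act_basis_expansion[OF that(1)]
      by (intro subspace_sum subspace_scale \<open>subspace N\<close> act_N that(2))
  qed
  ultimately have "lie_submodule gl_tilde s act N"
    by (simp add: lie_submodule_def)
  moreover have "M0 \<subseteq> N"
  proof
    fix v assume "v \<in> M0"
    have "act (basis (EE l1 l2)) v = 0" if far: "far m l1 l2" for l1 l2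
    proof -
      have "basis (EE l1 l2) \<in> gl_tilde_trunc m"
        using gl_tilde_trunc_pos[of l1 "- l2" m] gl_tilde_trunc_neg[of "- l1" l2 m] far
        by (auto simp: far_def uminus_half_ints)
      then show ?thesis using killed \<open>v \<in> M0\<close> by blast
    qed
    then show "v \<in> N" unfolding N_def by blast
  qed
  ultimately have "N = UNIV"
    using hull_minimal[of M0 N "lie_submodule gl_tilde s act"] M0 by auto
  then have "v \<in> N" by simp
  then show ?thesis using that by (auto simp: N_def far_def)
qed

end

section \<open>Operators along a diagonal\<close>

locale truncated_gl_tilde_module = gl_tilde_module s act
  for s :: "complex \<Rightarrow> 'v::ab_group_add \<Rightarrow> 'v" and act +
  fixes n :: nat
  assumes n_pos: "n \<ge> 1"
    and truncated: "\<exists>m. \<forall>l1\<in>half_ints. \<forall>l2\<in>half_ints.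
      l1 > of_nat m \<and> l2 < - of_nat m \<or> l1 < - of_nat m \<and> l2 > of_nat m \<longrightarrow> act (basis (EE l1 l2)) v = 0"
begin

text \<open>The matrix unit that takes \<open>t\<^bsup>\<iota>+b\<^esup> e\<^sub>j\<close> to \<open>t\<^bsup>\<iota>+a\<^esup> e\<^sub>i\<close>; products of the generators \<open>EE\<close> are nonzero when
  adjacent indices are opposite, whence the sign.\<close>

definition unit :: "nat \<Rightarrow> nat \<Rightarrow> int \<Rightarrow> int \<Rightarrow> 'v \<Rightarrow> 'v" where
  "unit i j a b = act (basis (EE (hidx n i a) (- hidx n j b)))"

definition central :: "'v \<Rightarrow> 'v" where
  "central = act (basis Kappa0)"

lemma EE_hidx_mem: "Poly_Mapping.single (EE (hidx n i a) (- hidx n j b)) c \<in> gl_tilde"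
  by (intro gl_tilde_EE hidx_half_ints uminus_half_ints)

lemma linear_unit: "Vector_Spaces.linear s s (unit i j a b)"
  unfolding unit_def by (intro linear_act EE_hidx_mem)

sublocale unit: Vector_Spaces.linear s s "unit i j a b" for i j a b
  by (rule linear_unit)

sublocale central: Vector_Spaces.linear s s central
  unfolding central_def by (intro linear_act gl_tilde_Kappa0)

lemma unit_central: "unit i j a b (central v) = central (unit i j a b v)"
  unfolding unit_def central_def by (rule act_Kappa0_commute[OF EE_hidx_mem])

text \<open>The central term \<open>H(l\<^sub>1) H(l\<^sub>2) - H(k\<^sub>1) H(k\<^sub>2)\<close> with \<open>k\<^sub>1 = - l\<^sub>2\<close> and \<open>k\<^sub>2 = - l\<^sub>1\<close> equals \<open>H(l\<^sub>1) - H(- l\<^sub>2)\<close>,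
  because \<open>H(- l) = 1 - H(l)\<close> for half-integers. It thus depends only on the signs of \<open>a1\<close> and
  \<open>b1\<close>.\<close>

lemma unit_commutator:
  assumes "i1 \<in> {1..n}" "j1 \<in> {1..n}" "i2 \<in> {1..n}" "j2 \<in> {1..n}"
  shows "unit i1 j1 a1 b1 (unit i2 j2 a2 b2 v) - unit i2 j2 a2 b2 (unit i1 j1 a1 b1 v)
    = (if j1 = i2 \<and> b1 = a2 then unit i1 j2 a1 b2 v else 0)
      - (if j2 = i1 \<and> b2 = a1 then unit i2 j1 a2 b1 v else 0)
      + (if j1 = i2 \<and> b1 = a2 \<and> j2 = i1 \<and> b2 = a1
         then s ((if a1 \<ge> 0 then 1 else 0) - (if b1 \<ge> 0 then 1 else 0)) (central v) else 0)"
proof -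
  let ?x = "basis (EE (hidx n i1 a1) (- hidx n j1 b1))" and ?y = "basis (EE (hidx n i2 a2) (- hidx n j2 b2))"
  let ?p = "j1 = i2 \<and> b1 = a2" and ?q = "j2 = i1 \<and> b2 = a1"
  let ?h = "(if a1 \<ge> 0 then 1 else 0) - (if b1 \<ge> 0 then 1 else 0) :: complex"
  have p: "- hidx n j1 b1 + hidx n i2 a2 = 0 \<longleftrightarrow> ?p" and q: "- hidx n j2 b2 + hidx n i1 a1 = 0 \<longleftrightarrow> ?q"
    using hidx_eq_iff[OF assms(2,3), of b1 a2] hidx_eq_iff[OF assms(4,1), of b2 a1] by auto
  have q': "hidx n i1 a1 + - hidx n j2 b2 = 0 \<longleftrightarrow> ?q"
    using q by (simp add: add.commute)
  have h: "heavi (hidx n i1 a1) * heavi (- hidx n j1 b1) - heavi (hidx n i2 a2) * heavi (- hidx n j2 b2) = ?h"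
    if ?p ?q
    using that by (simp add: heavi_hidx[OF assms(1)] heavi_hidx[OF assms(3)])
  define X where "X = (if ?p then basis (EE (hidx n i1 a1) (- hidx n j2 b2)) else 0)"
  define Y where "Y = (if ?q then basis (EE (hidx n i2 a2) (- hidx n j1 b1)) else 0)"
  define Z where "Z = (if ?q \<and> ?p then Poly_Mapping.single Kappa0 ?h else 0)"
  have heavi_Z: "(if ?q \<and> ?p then Poly_Mapping.single Kappa0
      (heavi (hidx n i1 a1) * heavi (- hidx n j1 b1) - heavi (hidx n i2 a2) * heavi (- hidx n j2 b2)) else 0) = Z"
  proof (cases "?q \<and> ?p")
    case True
    show ?thesis unfolding Z_def h[OF conjunct2[OF True] conjunct1[OF True]] ..
  qed (simp only: Z_def if_False)
  have "gl_tilde_bracket ?x ?y = X - Y + Z"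
    unfolding gl_tilde_bracket_basis gl_tilde_basis_bracket.simps EE_mult.simps p q q' heavi_Z X_def Y_def ..
  moreover have "X \<in> gl_tilde" "Y \<in> gl_tilde" "Z \<in> gl_tilde"
    by (simp_all add: X_def Y_def Z_def gl_tilde_0 EE_hidx_mem gl_tilde_Kappa0)
  ultimately have bracket: "act (gl_tilde_bracket ?x ?y) v = act X v - act Y v + act Z v"
    by (simp add: act_add_left act_diff_left gl_tilde_diff)
  have X: "act X v = (if ?p then unit i1 j2 a1 b2 v else 0)"
    unfolding X_def unit_def by (simp only: if_distrib[of "\<lambda>x. act x v"] act_0_left)
  have Y: "act Y v = (if ?q then unit i2 j1 a2 b1 v else 0)"
    unfolding Y_def unit_def by (simp only: if_distrib[of "\<lambda>x. act x v"] act_0_left)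
  have Z: "act Z v = (if ?q \<and> ?p then s ?h (central v) else 0)"
    unfolding Z_def central_def
    by (simp only: if_distrib[of "\<lambda>x. act x v"] act_single_Kappa0[of ?h] act_0_left)
  have "?q \<and> ?p \<longleftrightarrow> j1 = i2 \<and> b1 = a2 \<and> j2 = i1 \<and> b2 = a1"
    by blast
  moreover have "unit i1 j1 a1 b1 (unit i2 j2 a2 b2 v) - unit i2 j2 a2 b2 (unit i1 j1 a1 b1 v)
      = act (gl_tilde_bracket ?x ?y) v"
    unfolding unit_def by (rule act_bracket[OF EE_hidx_mem EE_hidx_mem, symmetric])
  ultimately show ?thesis
    by (simp only: bracket X Y Z)
qed

text \<open>The asymmetry between \<open>\<le>\<close> and \<open><\<close> reflects that the position of \<open>(i, a)\<close> is positive exactly for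
  \<open>a \<ge> 0\<close>.\<close>

definition vanishes_beyond :: "int \<Rightarrow> 'v \<Rightarrow> bool" where
  "vanishes_beyond K v \<longleftrightarrow> (\<forall>i\<in>{1..n}. \<forall>j\<in>{1..n}. \<forall>a b.
     K \<le> a \<and> K \<le> b \<or> a < - K \<and> b < - K \<longrightarrow> unit i j a b v = 0)"

lemma vanishes_beyondD:
  "vanishes_beyond K v \<Longrightarrow> i \<in> {1..n} \<Longrightarrow> j \<in> {1..n} \<Longrightarrow>
     K \<le> a \<and> K \<le> b \<or> a < - K \<and> b < - K \<Longrightarrow> unit i j a b v = 0"
  unfolding vanishes_beyond_def by blast

lemma vanishes_beyond_mono: "vanishes_beyond K v \<Longrightarrow> K \<le> K' \<Longrightarrow> vanishes_beyond K' v"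
  unfolding vanishes_beyond_def by force

lemma vanishes_beyond_exists: "\<exists>K\<ge>0. vanishes_beyond K v"
proof -
  obtain m where m: "\<And>l1 l2. l1 \<in> half_ints \<Longrightarrow> l2 \<in> half_ints \<Longrightarrow>
      l1 > of_nat m \<and> l2 < - of_nat m \<or> l1 < - of_nat m \<and> l2 > of_nat m \<Longrightarrow> act (basis (EE l1 l2)) v = 0"
    using truncated by meson
  have "unit i j a b v = 0"
    if "i \<in> {1..n}" "j \<in> {1..n}" "int m \<le> a \<and> int m \<le> b \<or> a < - int m \<and> b < - int m" for i j a b
    unfolding unit_def
    using that hidx_greater[of i n m a] hidx_greater[of j n m b] hidx_less[of i n a m] hidx_less[of j n b m]
    by (intro m hidx_half_ints uminus_half_ints) auto
  then have "vanishes_beyond (int m) v"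
    unfolding vanishes_beyond_def by blast
  then show ?thesis by (intro exI[of _ "int m"]) simp
qed

lemma vanishes_beyond_exists2: "\<exists>K\<ge>0. vanishes_beyond K v \<and> vanishes_beyond K w"
proof -
  obtain K K' where "vanishes_beyond K v" "K \<ge> 0" "vanishes_beyond K' w" "K' \<ge> 0"
    using vanishes_beyond_exists by metis
  then have "vanishes_beyond (max K K') v \<and> vanishes_beyond (max K K') w \<and> max K K' \<ge> 0"
    by (auto intro: vanishes_beyond_mono)
  then show ?thesis by blast
qed

text \<open>The matrix with entries \<open>f b\<close> along the \<open>k\<close>-th diagonal of the block \<open>(i, j)\<close>.\<close>

definition diag :: "int \<Rightarrow> (int \<Rightarrow> complex) \<Rightarrow> nat \<Rightarrow> nat \<Rightarrow> 'v \<Rightarrow> 'v" where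
  "diag k f i j v = Sum_any (\<lambda>b. s (f b) (unit i j (k + b) b v))"

lemma diag_eq_sum:
  assumes "vanishes_beyond K v" "i \<in> {1..n}" "j \<in> {1..n}" "N \<ge> K + \<bar>k\<bar>"
  shows "diag k f i j v = (\<Sum>b\<in>{- N..N}. s (f b) (unit i j (k + b) b v))"
  unfolding diag_def
proof (rule Sum_any.expand_superset)
  show "{b. s (f b) (unit i j (k + b) b v) \<noteq> 0} \<subseteq> {- N..N}"
  proof
    fix b assume "b \<in> {b. s (f b) (unit i j (k + b) b v) \<noteq> 0}"
    then have "\<not> (K \<le> k + b \<and> K \<le> b \<or> k + b < - K \<and> b < - K)"
      using vanishes_beyondD[OF assms(1-3), of "k + b" b] by auto
    then show "b \<in> {- N..N}" using assms(4) by auto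
  qed
qed simp

lemma linear_diag:
  assumes "i \<in> {1..n}" "j \<in> {1..n}"
  shows "Vector_Spaces.linear s s (diag k f i j)"
proof unfold_locales
  fix v w
  obtain K where "K \<ge> 0" and v: "vanishes_beyond K v" and w: "vanishes_beyond K w"
    using vanishes_beyond_exists2 by metis
  then have vw: "vanishes_beyond K (v + w)"
    by (simp add: vanishes_beyond_def unit.add)
  show "diag k f i j (v + w) = diag k f i j v + diag k f i j w"
    by (simp add: diag_eq_sum[OF v assms order_refl] diag_eq_sum[OF w assms order_refl]
        diag_eq_sum[OF vw assms order_refl] unit.add scale_right_distrib sum.distrib)
next
  fix c v
  obtain K where v: "vanishes_beyond K v"
    using vanishes_beyond_exists by metis
  then have cv: "vanishes_beyond K (s c v)"
    by (simp add: vanishes_beyond_def unit.scale)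
  show "diag k f i j (s c v) = s c (diag k f i j v)"
    by (simp add: diag_eq_sum[OF v assms order_refl] diag_eq_sum[OF cv assms order_refl]
        unit.scale scale_sum_right mult.commute)
qed

lemma diag_sum_fun:
  assumes "i \<in> {1..n}" "j \<in> {1..n}"
  shows "diag k (\<lambda>b. \<Sum>c\<in>A. z c * f c b) i j v = (\<Sum>c\<in>A. s (z c) (diag k (f c) i j v))"
proof -
  obtain K where v: "vanishes_beyond K v"
    using vanishes_beyond_exists by metis
  show ?thesis
    unfolding diag_eq_sum[OF v assms order_refl] scale_sum_left scale_sum_right
    by (subst sum.swap) simp
qed

lemma diag_central:
  assumes "i \<in> {1..n}" "j \<in> {1..n}"
  shows "diag k f i j (central v) = central (diag k f i j v)"
proof -
  obtain K where v: "vanishes_beyond K v"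
    using vanishes_beyond_exists by metis
  then have cv: "vanishes_beyond K (central v)"
    by (simp add: vanishes_beyond_def unit_central central.zero)
  show ?thesis
    by (simp add: diag_eq_sum[OF v assms order_refl] diag_eq_sum[OF cv assms order_refl]
        central.sum central.scale unit_central)
qed

text \<open>Expanding both products into finite double sums reduces this to the commutators of matrix units. A
  range that exceeds the support bound \<open>K\<close> by the two shifts \<open>\<bar>k\<bar>\<close> and \<open>\<bar>k'\<bar>\<close> is large enough that the terms of the
  product leaving it vanish.\<close>

lemma diag_commutator:
  assumes "i1 \<in> {1..n}" "j1 \<in> {1..n}" "i2 \<in> {1..n}" "j2 \<in> {1..n}"
  shows "diag k f i1 j1 (diag k' g i2 j2 v) - diag k' g i2 j2 (diag k f i1 j1 v)
    = (if j1 = i2 then diag (k + k') (\<lambda>b. f (k' + b) * g b) i1 j2 v else 0)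
      - (if j2 = i1 then diag (k + k') (\<lambda>a. f a * g (k + a)) i2 j1 v else 0)
      + (if j1 = i2 \<and> j2 = i1 \<and> k + k' = 0 then s (cocycle k (\<lambda>a. f a * g (k + a))) (central v) else 0)"
proof -
  obtain K1 where K1: "K1 \<ge> 0" "vanishes_beyond K1 v" "vanishes_beyond K1 (diag k f i1 j1 v)"
    using vanishes_beyond_exists2 by metis
  obtain K2 where K2: "K2 \<ge> 0" "vanishes_beyond K2 (diag k' g i2 j2 v)"
    using vanishes_beyond_exists by metis
  define K where "K = max K1 K2"
  have K: "K \<ge> 0" "vanishes_beyond K v" "vanishes_beyond K (diag k f i1 j1 v)"
      "vanishes_beyond K (diag k' g i2 j2 v)"
    using K1 K2 by (auto simp: K_def intro: vanishes_beyond_mono)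
  define N where "N = K + \<bar>k\<bar> + \<bar>k'\<bar>"
  let ?I = "{- N..N}"
  have N: "N \<ge> K + \<bar>k\<bar>" "N \<ge> K + \<bar>k'\<bar>" "N \<ge> K + \<bar>k + k'\<bar>" "\<bar>k\<bar> \<le> N"
    using K(1) by (auto simp: N_def)
  let ?U = "\<lambda>a. unit i1 j1 (k + a) a" and ?W = "\<lambda>b. unit i2 j2 (k' + b) b"
  define T1 where "T1 a b = (if j1 = i2 \<and> a = k' + b then s (f a * g b) (unit i1 j2 (k + a) b v) else 0)" for a b
  define T2 where "T2 a b = (if j2 = i1 \<and> b = k + a then s (f a * g b) (unit i2 j1 (k' + b) a v) else 0)" for a b
  define T3 where "T3 a b = (if j1 = i2 \<and> a = k' + b \<and> j2 = i1 \<and> b = k + a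
      then s (f a * g b * ((if k + a \<ge> 0 then 1 else 0) - (if a \<ge> 0 then 1 else 0))) (central v) else 0)" for a b
  have "diag k f i1 j1 (diag k' g i2 j2 v) = (\<Sum>a\<in>?I. s (f a) (?U a (\<Sum>b\<in>?I. s (g b) (?W b v))))"
    unfolding diag_eq_sum[OF K(4) assms(1,2) N(1)] by (simp only: diag_eq_sum[OF K(2) assms(3,4) N(2)])
  then have prod1: "diag k f i1 j1 (diag k' g i2 j2 v) = (\<Sum>a\<in>?I. \<Sum>b\<in>?I. s (f a * g b) (?U a (?W b v)))"
    by (simp add: unit.sum unit.scale scale_sum_right)
  have "diag k' g i2 j2 (diag k f i1 j1 v) = (\<Sum>b\<in>?I. s (g b) (?W b (\<Sum>a\<in>?I. s (f a) (?U a v))))"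
    unfolding diag_eq_sum[OF K(3) assms(3,4) N(2)] by (simp only: diag_eq_sum[OF K(2) assms(1,2) N(1)])
  also have "\<dots> = (\<Sum>b\<in>?I. \<Sum>a\<in>?I. s (f a * g b) (?W b (?U a v)))"
    by (simp add: unit.sum unit.scale scale_sum_right mult.commute)
  also have "\<dots> = (\<Sum>a\<in>?I. \<Sum>b\<in>?I. s (f a * g b) (?W b (?U a v)))"
    by (rule sum.swap)
  finally have "diag k f i1 j1 (diag k' g i2 j2 v) - diag k' g i2 j2 (diag k f i1 j1 v)
      = (\<Sum>a\<in>?I. \<Sum>b\<in>?I. s (f a * g b) (?U a (?W b v) - ?W b (?U a v)))"
    by (simp only: prod1 sum_subtractf scale_right_diff_distrib)
  also have "\<dots> = (\<Sum>a\<in>?I. \<Sum>b\<in>?I. T1 a b - T2 a b + T3 a b)"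
    by (intro sum.cong refl)
       (simp only: unit_commutator[OF assms] T1_def T2_def T3_def scale_right_distrib scale_right_diff_distrib
         if_distrib[of "s (f _ * g _)"] scale_scale scale_zero_right)
  also have "\<dots> = (\<Sum>a\<in>?I. \<Sum>b\<in>?I. T1 a b) - (\<Sum>a\<in>?I. \<Sum>b\<in>?I. T2 a b) + (\<Sum>a\<in>?I. \<Sum>b\<in>?I. T3 a b)"
    by (simp only: sum.distrib sum_subtractf)
  also have "(\<Sum>a\<in>?I. \<Sum>b\<in>?I. T1 a b)
      = (if j1 = i2 then diag (k + k') (\<lambda>b. f (k' + b) * g b) i1 j2 v else 0)"
  proof (cases "j1 = i2")
    case True
    have "(\<Sum>a\<in>?I. T1 a b) = s (f (k' + b) * g b) (unit i1 j2 (k + k' + b) b v)" if "b \<in> ?I" for b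
    proof (cases "k' + b \<in> ?I")
      case True
      then show ?thesis using \<open>j1 = i2\<close> by (simp add: T1_def add.assoc)
    next
      case False
      then have "unit i1 j2 (k + k' + b) b v = 0"
        using K(1) by (intro vanishes_beyondD[OF K(2) assms(1,4)]) (auto simp: N_def)
      moreover have "(\<Sum>a\<in>?I. T1 a b) = 0"
        using False by (intro sum.neutral) (auto simp: T1_def)
      ultimately show ?thesis by simp
    qed
    then have "(\<Sum>a\<in>?I. \<Sum>b\<in>?I. T1 a b) = diag (k + k') (\<lambda>b. f (k' + b) * g b) i1 j2 v"
      unfolding diag_eq_sum[OF K(2) assms(1,4) N(3)] by (subst sum.swap) simp
    then show ?thesis using True by simp
  qed (simp add: T1_def)
  also have "(\<Sum>a\<in>?I. \<Sum>b\<in>?I. T2 a b)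
      = (if j2 = i1 then diag (k + k') (\<lambda>a. f a * g (k + a)) i2 j1 v else 0)"
  proof (cases "j2 = i1")
    case True
    have "(\<Sum>b\<in>?I. T2 a b) = s (f a * g (k + a)) (unit i2 j1 (k + k' + a) a v)" if "a \<in> ?I" for a
    proof (cases "k + a \<in> ?I")
      case True
      then show ?thesis using \<open>j2 = i1\<close> by (simp add: T2_def ac_simps)
    next
      case False
      then have "unit i2 j1 (k + k' + a) a v = 0"
        using K(1) by (intro vanishes_beyondD[OF K(2) assms(3,2)]) (auto simp: N_def)
      moreover have "(\<Sum>b\<in>?I. T2 a b) = 0"
        using False by (intro sum.neutral) (auto simp: T2_def)
      ultimately show ?thesis by simp
    qed
    then show ?thesis
      unfolding diag_eq_sum[OF K(2) assms(3,2) N(3)] using True by simp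
  qed (simp add: T2_def)
  also have "(\<Sum>a\<in>?I. \<Sum>b\<in>?I. T3 a b)
      = (if j1 = i2 \<and> j2 = i1 \<and> k + k' = 0 then s (cocycle k (\<lambda>a. f a * g (k + a))) (central v) else 0)"
  proof (cases "j1 = i2 \<and> j2 = i1 \<and> k + k' = 0")
    case True
    define h :: "int \<Rightarrow> complex" where
      "h a = (if k + a \<ge> 0 then 1 else 0) - (if a \<ge> 0 then 1 else 0)" for a
    have "(\<Sum>b\<in>?I. T3 a b) = s (f a * g (k + a) * h a) (central v)" if "a \<in> ?I" for a
    proof (cases "k + a \<in> ?I")
      case True
      have "T3 a b = (if b = k + a then s (f a * g b * h a) (central v) else 0)" for b
      proof -
        have "a = k' + b \<longleftrightarrow> b = k + a"
          using \<open>j1 = i2 \<and> j2 = i1 \<and> k + k' = 0\<close> by linarith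
        then show ?thesis
          using \<open>j1 = i2 \<and> j2 = i1 \<and> k + k' = 0\<close> by (simp only: T3_def h_def simp_thms)
      qed
      then show ?thesis using True by simp
    next
      case False
      then have "h a = 0"
        using that K(1) by (auto simp: N_def h_def)
      moreover have "T3 a b = 0" if "b \<in> ?I" for b
      proof -
        have "b \<noteq> k + a" using False that by blast
        then show ?thesis by (simp only: T3_def if_False simp_thms)
      qed
      then have "(\<Sum>b\<in>?I. T3 a b) = 0"
        by (intro sum.neutral) blast
      ultimately show ?thesis by (simp only: mult_zero_right scale_zero_left)
    qed
    then have "(\<Sum>a\<in>?I. \<Sum>b\<in>?I. T3 a b) = (\<Sum>a\<in>?I. s (f a * g (k + a) * h a) (central v))"
      by (rule sum.cong[OF refl])
    also have "\<dots> = s (cocycle k (\<lambda>a. f a * g (k + a))) (central v)"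
      unfolding h_def scale_sum_left[symmetric] cocycle_eq_sum[OF N(4)] ..
    finally show ?thesis using True by (simp only: if_True simp_thms)
  next
    case False
    have "T3 a b = 0" for a b
    proof -
      have "k + k' = 0" if "a = k' + b" "b = k + a" using that by linarith
      then have "\<not> (j1 = i2 \<and> a = k' + b \<and> j2 = i1 \<and> b = k + a)" using False by blast
      then show ?thesis by (simp only: T3_def if_False)
    qed
    then show ?thesis by (simp only: False if_False sum.neutral_const)
  qed
  finally show ?thesis .
qed

end

section \<open>The representation\<close>

definition hat_basis :: "nat \<Rightarrow> hat_index set" where
  "hat_basis n = insert Kappa {TD m r i j | m r i j. i \<in> {1..n} \<and> j \<in> {1..n}}"

lemma keys_dmat: "Poly_Mapping.keys (dmat a i j) \<subseteq> {TD m r i j | m r. True}"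
proof -
  have "dmat a i j = (\<Sum>p\<in>Poly_Mapping.keys a. fscale (Poly_Mapping.lookup a p) (case p of (m, r) \<Rightarrow> basis (TD m r i j)))"
    by (simp add: dmat_def lin_ext_def)
  also have "Poly_Mapping.keys \<dots> \<subseteq> {TD m r i j | m r. True}"
  proof (rule order_trans[OF Poly_Mapping.keys_sum], rule UN_least)
    fix p
    show "Poly_Mapping.keys (fscale (Poly_Mapping.lookup a p) (case p of (m, r) \<Rightarrow> basis (TD m r i j)))
        \<subseteq> {TD m r i j | m r. True}"
      by (cases p) (auto simp: fscale_single)
  qed
  finally show ?thesis .
qed

lemma keys_gl_hat:
  assumes "x \<in> gl_hat n"
  shows "Poly_Mapping.keys x \<subseteq> hat_basis n"
proof -
  obtain a c where x: "x = (\<Sum>i=1..n. \<Sum>j=1..n. dmat (a i j) i j) + Poly_Mapping.single Kappa c"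
    using assms unfolding gl_hat_def by blast
  have entry: "Poly_Mapping.keys (dmat (a i j) i j) \<subseteq> hat_basis n" if "i \<in> {1..n}" "j \<in> {1..n}" for i j
    using keys_dmat[of "a i j" i j] that unfolding hat_basis_def by blast
  have "Poly_Mapping.keys (\<Sum>i=1..n. \<Sum>j=1..n. dmat (a i j) i j) \<subseteq> hat_basis n"
    by (rule order_trans[OF Poly_Mapping.keys_sum], rule UN_least,
        rule order_trans[OF Poly_Mapping.keys_sum], rule UN_least, rule entry)
  moreover have "Poly_Mapping.keys (Poly_Mapping.single Kappa c) \<subseteq> hat_basis n"
    by (simp add: hat_basis_def)
  ultimately show ?thesis
    unfolding x by (rule order_trans[OF Poly_Mapping.keys_add Un_least])
qed

lemma dmat_0: "dmat 0 i j = 0"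
  by (simp add: dmat_def lin_ext_def)

lemma diffop_mult_0: "diffop_mult 0 y = 0"
  by (simp add: diffop_mult_def bilin_ext_def lin_ext_def)

lemma Kappa_in_gl_hat_sub: "basis Kappa \<in> gl_hat_sub n ell"
  unfolding gl_hat_sub_def mem_Collect_eq
  by (intro exI[of _ "\<lambda>i j. 0"] exI[of _ 1]) (simp add: diffop_mult_0 dmat_0)

text \<open>So the subalgebra contains \<open>t\<^sup>m \<partial>\<^sup>r E\<^sub>i\<^sub>j\<close> for all \<open>r \<ge> \<ell>\<^sub>j\<close>.\<close>

lemma dmat_mult_dpow: "dmat (diffop_mult (basis (m, r)) (basis (0, l))) i j = basis (TD m (r + l) i j)"
proof -
  have "Poly_Mapping.single (TD (m + 0 - int k) (r + l - k) i j) (of_nat (r choose k) * ffact (of_int 0) k)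
      = (if k = 0 then basis (TD m (r + l) i j) else 0)" for k
  proof (cases k)
    case 0
    then show ?thesis by (simp add: ffact_def)
  next
    case (Suc k')
    then show ?thesis by (simp add: ffact_gbinomial gbinomial_0)
  qed
  then show ?thesis unfolding dmat_mult_basis by simp
qed

lemma TD_in_gl_hat_sub:
  assumes "i \<in> {1..n}" "j \<in> {1..n}"
  shows "basis (TD m (r + ell j) i j) \<in> gl_hat_sub n ell"
proof -
  define a where "a i' j' = (if i' = i \<and> j' = j then basis (m, r) else 0)" for i' j'
  have "dmat (diffop_mult (a i' j') (basis (0, ell j'))) i' j'
      = (if i' = i then if j' = j then basis (TD m (r + ell j) i j) else 0 else 0)" for i' j'
    by (simp add: a_def diffop_mult_0 dmat_0 dmat_mult_dpow)
  then have "(\<Sum>i'=1..n. \<Sum>j'=1..n. dmat (diffop_mult (a i' j') (basis (0, ell j'))) i' j')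
      = (\<Sum>i'=1..n. if i' = i then basis (TD m (r + ell j) i j) else 0)"
    using assms(2) by (intro sum.cong refl) simp
  then show ?thesis
    unfolding gl_hat_sub_def mem_Collect_eq
    using assms(1) by (intro exI[of _ a] exI[of _ 0]) simp
qed

lemma lie_module_mono:
  assumes "lie_module L br s act" and "L' \<subseteq> L"
  shows "lie_module L' br s act"
proof -
  interpret lie_module L br s act by fact
  note L = subsetD[OF assms(2)]
  show ?thesis
    by unfold_locales
       (simp_all only: L act_add_right act_scale_right act_add_left act_scale_left act_bracket)
qed

context gl_tilde_module
begin

lemma linear_sigma: "Vector_Spaces.linear fscale s (\<lambda>x. sigma n \<iota> s act x v)"
  unfolding sigma_def by (rule linear_lin_ext) unfold_locales

lemma sigma_single: "sigma n \<iota> s act (Poly_Mapping.single b c) v = s c (sigma_basis n \<iota> s act b v)"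
  unfolding sigma_def by (rule lin_ext_single) unfold_locales

text \<open>Each operator of \<open>\<sigma>\<close> is pointwise a finite linear combination of operators of the big algebra; where the
  sum over \<open>l\<close> has infinite support, its value is \<open>0\<close> by convention.\<close>

lemma sigma_in_submodule:
  assumes "lie_submodule gl_tilde s act N" and "v \<in> N"
  shows "sigma n \<iota> s act x v \<in> N"
proof -
  have N: "subspace N" and act_N: "x \<in> gl_tilde \<Longrightarrow> act x v \<in> N" for x
    using assms by (auto simp: lie_submodule_def)
  have "sigma_basis n \<iota> s act b v \<in> N" for b
  proof (cases b)
    case (TD m r i j)
    have half: "of_int k - 1 / 2 \<in> half_ints" "of_int k + 1 / 2 \<in> half_ints" for k
    proof -
      have "(of_int k - 1 / 2 :: rat) = of_int (k - 1) + 1 / 2" by simp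
      then show "of_int k - 1 / 2 \<in> half_ints" unfolding half_ints_def by blast
    qed (auto simp: half_ints_def)
    show ?thesis
      unfolding TD sigma_basis.simps Sum_any.expand_set
      by (intro subspace_add subspace_sum subspace_scale N act_N gl_tilde_EE gl_tilde_Kappa0 half)
  next
    case Kappa
    then show ?thesis by (simp add: act_N gl_tilde_Kappa0)
  qed
  then show ?thesis
    unfolding sigma_def lin_ext_def by (intro subspace_sum subspace_scale N)
qed

end

context truncated_gl_tilde_module
begin

text \<open>Substituting \<open>l = - b\<close>; the constant \<open>r! \<Im>\<^bsub>0,r\<^esub>\<close> equals \<open>- \<langle>\<iota>\<rangle>\<^bsub>r+1\<^esub> / (r + 1)\<close>.\<close>

lemma sigma_basis_TD:
  "sigma_basis n \<iota> s act (TD m r i j) v = diag (m - int r) (\<lambda>b. ffact (\<iota> + of_int b) r) i j v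
     + s (if i = j \<and> int r = m then - (ffact \<iota> (Suc r) / of_nat (Suc r)) else 0) (central v)"
proof -
  have "fact r * J_coeff \<iota> 0 r = - (ffact \<iota> (Suc r) / of_nat (Suc r))"
    by (simp add: J_coeff_0 ffact_gbinomial del: of_nat_Suc)
  moreover have "Sum_any (\<lambda>l::int. s (ffact (\<iota> - of_int l) r)
       (act (basis (EE (of_int ((m - int r - l) * int n + int i) - 1 / 2)
                       (of_int (l * int n - int j) + 1 / 2))) v))
      = diag (m - int r) (\<lambda>b. ffact (\<iota> + of_int b) r) i j v"
    unfolding diag_def
  proof (rule Sum_any.reindex_cong[of uminus])
    show "bij (uminus :: int \<Rightarrow> int)" by (rule bij_uminus)
  qed (auto simp: unit_def hidx_def fun_eq_iff algebra_simps)
  ultimately show ?thesis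
    by (simp add: central_def)
qed

lemma sigma_basis_Kappa: "sigma_basis n \<iota> s act Kappa v = central v"
  by (simp add: central_def)

lemma linear_sigma_basis:
  assumes "b \<in> hat_basis n"
  shows "Vector_Spaces.linear s s (sigma_basis n \<iota> s act b)"
proof (cases b)
  case (TD m r i j)
  then have "i \<in> {1..n}" "j \<in> {1..n}" using assms by (auto simp: hat_basis_def)
  then interpret D: Vector_Spaces.linear s s "diag k f i j" for k f by (rule linear_diag)
  show ?thesis
    unfolding TD
    by unfold_locales (simp_all only: sigma_basis_TD D.add D.scale central.add central.scale
        scale_right_distrib scale_scale ac_simps)
next
  case Kappa
  show ?thesis
    unfolding Kappa
    by unfold_locales (simp_all only: sigma_basis_Kappa central.add central.scale)
qed

text \<open>All terms of the Leibniz expansion of the product lie on the same diagonal, and their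
  coefficients add up to those of the composition of the two operators.\<close>

lemma sigma_dmat_mult:
  assumes "i \<in> {1..n}" "j \<in> {1..n}"
  shows "sigma n \<iota> s act (dmat (diffop_mult (basis (m1, r1)) (basis (m2, r2))) i j) v
    = diag (m1 - int r1 + (m2 - int r2))
        (\<lambda>b. ffact (\<iota> + of_int b) r2 * ffact (\<iota> + of_int (m2 - int r2 + b)) r1) i j v
      + s (if i = j \<and> m1 - int r1 + (m2 - int r2) = 0 then - ffact_trace m2 r1 r2 \<iota> else 0) (central v)"
proof -
  interpret S: Vector_Spaces.linear fscale s "\<lambda>x. sigma n \<iota> s act x v" by (rule linear_sigma)
  define K where "K = m1 - int r1 + (m2 - int r2)"
  define z :: "nat \<Rightarrow> complex" where "z k = of_nat (r1 choose k) * ffact (of_int m2) k" for k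
  define t :: "nat \<Rightarrow> complex" where "t k = ffact \<iota> (Suc (r1 + r2 - k)) / of_nat (Suc (r1 + r2 - k))" for k
  have TD: "sigma_basis n \<iota> s act (TD (m1 + m2 - int k) (r1 + r2 - k) i j) v
      = diag K (\<lambda>b. ffact (\<iota> + of_int b) (r1 + r2 - k)) i j v + s (if i = j \<and> K = 0 then - t k else 0) (central v)"
    if "k \<le> r1" for k
  proof -
    have "m1 + m2 - int k - int (r1 + r2 - k) = K"
      and "int (r1 + r2 - k) = m1 + m2 - int k \<longleftrightarrow> K = 0"
      using that by (auto simp: K_def of_nat_diff)
    then show ?thesis unfolding sigma_basis_TD t_def by simp
  qed
  have "sigma n \<iota> s act (dmat (diffop_mult (basis (m1, r1)) (basis (m2, r2))) i j) v
      = (\<Sum>k\<le>r1. s (z k) (sigma_basis n \<iota> s act (TD (m1 + m2 - int k) (r1 + r2 - k) i j) v))"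
    unfolding dmat_mult_basis S.sum by (simp add: sigma_single z_def)
  also have "\<dots> = (\<Sum>k\<le>r1. s (z k) (diag K (\<lambda>b. ffact (\<iota> + of_int b) (r1 + r2 - k)) i j v)
      + s (z k * (if i = j \<and> K = 0 then - t k else 0)) (central v))"
    by (intro sum.cong refl) (simp only: TD atMost_iff scale_right_distrib scale_scale)
  also have "\<dots> = diag K (\<lambda>b. \<Sum>k\<le>r1. z k * ffact (\<iota> + of_int b) (r1 + r2 - k)) i j v
      + s (\<Sum>k\<le>r1. z k * (if i = j \<and> K = 0 then - t k else 0)) (central v)"
    by (simp only: sum.distrib diag_sum_fun[OF assms] scale_sum_left)
  also have "(\<Sum>k\<le>r1. z k * (if i = j \<and> K = 0 then - t k else 0))
      = (if i = j \<and> K = 0 then - ffact_trace m2 r1 r2 \<iota> else 0)"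
  proof (cases "i = j \<and> K = 0")
    case True
    then show ?thesis by (simp add: ffact_trace_def z_def t_def sum_negf)
  qed (simp only: if_False mult_zero_right sum.neutral_const)
  also have "(\<lambda>b. \<Sum>k\<le>r1. z k * ffact (\<iota> + of_int b) (r1 + r2 - k))
      = (\<lambda>b. ffact (\<iota> + of_int b) r2 * ffact (\<iota> + of_int (m2 - int r2 + b)) r1)"
    unfolding z_def ffact_compose by (simp add: algebra_simps)
  finally show ?thesis unfolding K_def .
qed

text \<open>The noncentral parts of both sides agree term by term. On opposite diagonals the commutator of the two operators has
  the central term \<open>cocycle\<close>, while the products on the left carry the constants \<open>- ffact_trace\<close>; these
  match by \<open>cocycle_ffact\<close>. The constants in \<open>\<sigma>(b1)\<close> and \<open>\<sigma>(b2)\<close> themselves cancel in the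
  commutator.\<close>

lemma sigma_basis_bracket:
  assumes "b1 \<in> hat_basis n" "b2 \<in> hat_basis n"
  shows "sigma n \<iota> s act (gl_hat_basis_bracket b1 b2) v
    = sigma_basis n \<iota> s act b1 (sigma_basis n \<iota> s act b2 v) - sigma_basis n \<iota> s act b2 (sigma_basis n \<iota> s act b1 v)"
proof -
  interpret S: Vector_Spaces.linear fscale s "\<lambda>x. sigma n \<iota> s act x v" by (rule linear_sigma)
  have TD_central: "sigma_basis n \<iota> s act (TD m r i j) (central v) = central (sigma_basis n \<iota> s act (TD m r i j) v)"
    if "TD m r i j \<in> hat_basis n" for m r i j
  proof -
    have "i \<in> {1..n}" "j \<in> {1..n}" using that by (auto simp: hat_basis_def)
    then show ?thesis by (simp only: sigma_basis_TD diag_central central.add central.scale)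
  qed
  show ?thesis
  proof (cases b1)
    case Kappa
    then show ?thesis
      using TD_central assms by (cases b2) (simp_all only: gl_hat_basis_bracket.simps S.zero sigma_basis_Kappa diff_self)
  next
    case b1: (TD m1 r1 i1 j1)
    show ?thesis
    proof (cases b2)
      case Kappa
      then show ?thesis
        using TD_central assms b1 by (simp only: gl_hat_basis_bracket.simps S.zero sigma_basis_Kappa diff_self)
    next
      case b2: (TD m2 r2 i2 j2)
      have range: "i1 \<in> {1..n}" "j1 \<in> {1..n}" "i2 \<in> {1..n}" "j2 \<in> {1..n}"
        using assms b1 b2 by (auto simp: hat_basis_def)
      interpret D1: Vector_Spaces.linear s s "diag k f i1 j1" for k f by (rule linear_diag[OF range(1,2)])
      interpret D2: Vector_Spaces.linear s s "diag k f i2 j2" for k f by (rule linear_diag[OF range(3,4)])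
      define k1 where "k1 = m1 - int r1"
      define k2 where "k2 = m2 - int r2"
      define f where "f b = ffact (\<iota> + of_int b) r1" for b :: int
      define g where "g b = ffact (\<iota> + of_int b) r2" for b :: int
      define c :: complex where "c = (- 1) ^ r1 * fact r1 * fact r2 * (of_int m1 gchoose (r1 + r2 + 1))"
      have level: "int (r1 + r2) = m1 + m2 \<longleftrightarrow> k1 + k2 = 0"
        by (auto simp: k1_def k2_def)
      have cocycle: "cocycle k1 (\<lambda>a. f a * g (k1 + a)) = ffact_trace m1 r2 r1 \<iota> - ffact_trace m2 r1 r2 \<iota> + c"
        if "k1 + k2 = 0"
        using cocycle_ffact[of m1 m2 r1 r2 \<iota>] that level by (simp add: f_def g_def k1_def c_def)
      have "(\<lambda>b. f (k2 + b) * g b) = (\<lambda>b. ffact (\<iota> + of_int b) r2 * ffact (\<iota> + of_int (m2 - int r2 + b)) r1)"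
        by (simp add: f_def g_def k2_def mult.commute)
      then have prod12: "sigma n \<iota> s act (dmat (diffop_mult (basis (m1, r1)) (basis (m2, r2))) i1 j2) v
          = diag (k1 + k2) (\<lambda>b. f (k2 + b) * g b) i1 j2 v
            + s (if i1 = j2 \<and> k1 + k2 = 0 then - ffact_trace m2 r1 r2 \<iota> else 0) (central v)"
        unfolding sigma_dmat_mult[OF range(1,4)] k1_def k2_def by simp
      have "(\<lambda>a. f a * g (k1 + a)) = (\<lambda>b. ffact (\<iota> + of_int b) r1 * ffact (\<iota> + of_int (m1 - int r1 + b)) r2)"
        by (simp add: f_def g_def k1_def)
      then have prod21: "sigma n \<iota> s act (dmat (diffop_mult (basis (m2, r2)) (basis (m1, r1))) i2 j1) v
          = diag (k1 + k2) (\<lambda>a. f a * g (k1 + a)) i2 j1 v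
            + s (if i2 = j1 \<and> k1 + k2 = 0 then - ffact_trace m1 r2 r1 \<iota> else 0) (central v)"
        unfolding sigma_dmat_mult[OF range(3,2)] k1_def k2_def by (simp add: add.commute)
      have "sigma_basis n \<iota> s act b1 (sigma_basis n \<iota> s act b2 v) - sigma_basis n \<iota> s act b2 (sigma_basis n \<iota> s act b1 v)
          = diag k1 f i1 j1 (diag k2 g i2 j2 v) - diag k2 g i2 j2 (diag k1 f i1 j1 v)"
        unfolding b1 b2 sigma_basis_TD k1_def[symmetric] k2_def[symmetric] f_def[symmetric] g_def[symmetric]
          D1.add D2.add D1.scale D2.scale diag_central[OF range(1,2)] diag_central[OF range(3,4)]
          central.add central.scale scale_right_distrib scale_scale
        by (simp add: mult.commute)
      also have "\<dots> = sigma n \<iota> s act (gl_hat_basis_bracket b1 b2) v"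
      proof -
        have "sigma n \<iota> s act (gl_hat_basis_bracket b1 b2) v
            = (if j1 = i2 then sigma n \<iota> s act (dmat (diffop_mult (basis (m1, r1)) (basis (m2, r2))) i1 j2) v else 0)
              - (if i1 = j2 then sigma n \<iota> s act (dmat (diffop_mult (basis (m2, r2)) (basis (m1, r1))) i2 j1) v else 0)
              + (if i1 = j2 \<and> j1 = i2 \<and> k1 + k2 = 0 then s c (central v) else 0)"
          unfolding b1 b2 gl_hat_basis_bracket.simps level c_def[symmetric] S.add S.diff
          by (simp only: if_distrib[of "\<lambda>x. sigma n \<iota> s act x v"] S.zero sigma_single sigma_basis_Kappa)
        also have "\<dots> = diag k1 f i1 j1 (diag k2 g i2 j2 v) - diag k2 g i2 j2 (diag k1 f i1 j1 v)"
          unfolding diag_commutator[OF range] prod12 prod21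
          by (cases "j1 = i2"; cases "i1 = j2"; cases "k1 + k2 = 0")
             (simp_all add: cocycle scale_left_distrib scale_left_diff_distrib)
        finally show ?thesis by (rule sym)
      qed
      finally show ?thesis by (rule sym)
    qed
  qed
qed

lemma sigma_lie_module: "lie_module (gl_hat n) gl_hat_bracket s (sigma n \<iota> s act)"
proof unfold_locales
  fix x y v w c
  interpret Sx: Vector_Spaces.linear fscale s "\<lambda>x. sigma n \<iota> s act x v" for v by (rule linear_sigma)
  show "sigma n \<iota> s act (x + y) v = sigma n \<iota> s act x v + sigma n \<iota> s act y v"
    by (rule Sx.add)
  show "sigma n \<iota> s act (fscale c x) v = s c (sigma n \<iota> s act x v)"
    by (rule Sx.scale)
  assume x: "x \<in> gl_hat n"
  let ?\<rho> = "sigma_basis n \<iota> s act"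
  have mem: "b \<in> hat_basis n" if "b \<in> Poly_Mapping.keys x" for b
    using keys_gl_hat[OF x] that by blast
  have add: "?\<rho> b (v + w) = ?\<rho> b v + ?\<rho> b w" and scale: "?\<rho> b (s c v) = s c (?\<rho> b v)"
    if "b \<in> hat_basis n" for b c v w
  proof -
    interpret R: Vector_Spaces.linear s s "?\<rho> b" by (rule linear_sigma_basis[OF that])
    show "?\<rho> b (v + w) = ?\<rho> b v + ?\<rho> b w" by (rule R.add)
    show "?\<rho> b (s c v) = s c (?\<rho> b v)" by (rule R.scale)
  qed
  show "sigma n \<iota> s act x (v + w) = sigma n \<iota> s act x v + sigma n \<iota> s act x w"
    by (simp add: sigma_def lin_ext_def add[OF mem] scale_right_distrib sum.distrib)
  show "sigma n \<iota> s act x (s c v) = s c (sigma n \<iota> s act x v)"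
    by (simp add: sigma_def lin_ext_def scale[OF mem] scale_sum_right mult.commute)
  assume y: "y \<in> gl_hat n"
  have mem': "b \<in> hat_basis n" if "b \<in> Poly_Mapping.keys y" for b
    using keys_gl_hat[OF y] that by blast
  let ?x = "Poly_Mapping.lookup x" and ?y = "Poly_Mapping.lookup y"
  let ?X = "Poly_Mapping.keys x" and ?Y = "Poly_Mapping.keys y"
  have comp: "sigma n \<iota> s act u (sigma n \<iota> s act w v)
      = (\<Sum>a\<in>Poly_Mapping.keys u. \<Sum>b\<in>Poly_Mapping.keys w.
          s (Poly_Mapping.lookup u a * Poly_Mapping.lookup w b) (?\<rho> a (?\<rho> b v)))"
    if "Poly_Mapping.keys u \<subseteq> hat_basis n" for u w
  proof -
    have "?\<rho> a (sigma n \<iota> s act w v) = (\<Sum>b\<in>Poly_Mapping.keys w. s (Poly_Mapping.lookup w b) (?\<rho> a (?\<rho> b v)))"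
      if "a \<in> hat_basis n" for a
    proof -
      interpret R: Vector_Spaces.linear s s "?\<rho> a" by (rule linear_sigma_basis[OF that])
      show ?thesis by (simp only: sigma_def lin_ext_def R.sum R.scale)
    qed
    then show ?thesis
      using that unfolding sigma_def[of n \<iota> s act u] lin_ext_def
      by (intro sum.cong refl) (auto simp: scale_sum_right)
  qed
  have "sigma n \<iota> s act (gl_hat_bracket x y) v
      = (\<Sum>a\<in>?X. s (?x a) (\<Sum>b\<in>?Y. s (?y b) (sigma n \<iota> s act (gl_hat_basis_bracket a b) v)))"
    unfolding gl_hat_bracket_def bilin_ext_def lin_ext_def[of fscale] by (simp only: Sx.sum Sx.scale)
  also have "\<dots> = (\<Sum>a\<in>?X. s (?x a) (\<Sum>b\<in>?Y. s (?y b) (?\<rho> a (?\<rho> b v) - ?\<rho> b (?\<rho> a v))))"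
    by (intro sum.cong refl arg_cong[of _ _ "s _"] sigma_basis_bracket mem mem')
  also have "\<dots> = (\<Sum>a\<in>?X. \<Sum>b\<in>?Y. s (?x a * ?y b) (?\<rho> a (?\<rho> b v)))
      - (\<Sum>a\<in>?X. \<Sum>b\<in>?Y. s (?y b * ?x a) (?\<rho> b (?\<rho> a v)))"
    by (simp add: scale_sum_right scale_right_diff_distrib sum_subtractf mult.commute)
  also have "\<dots> = sigma n \<iota> s act x (sigma n \<iota> s act y v) - sigma n \<iota> s act y (sigma n \<iota> s act x v)"
    unfolding comp[OF keys_gl_hat[OF x]] comp[OF keys_gl_hat[OF y]] by (subst (2) sum.swap) (rule refl)
  finally show "sigma n \<iota> s act (gl_hat_bracket x y) v
      = sigma n \<iota> s act x (sigma n \<iota> s act y v) - sigma n \<iota> s act y (sigma n \<iota> s act x v)" .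
qed

section \<open>Submodules\<close>

text \<open>On a vector \<open>v\<close>, a diagonal operator is a finite sum over \<open>b\<close>, and its coefficients \<open>\<langle>\<iota>+b\<rangle>\<^bsub>q+\<ell>\<^esub>\<close> can be chosen with
  any \<open>q\<close>. Up to the factor \<open>\<langle>\<iota>+b\<rangle>\<^sub>\<ell>\<close> these are the \<open>q\<close>-th factorial moments at the
  points \<open>\<iota>+b-\<ell>\<close>, so each single term lies in the submodule.\<close>

lemma sigma_submodule_is_submodule:
  assumes "\<iota> \<notin> \<int>" and sub: "lie_submodule (gl_hat_sub n ell) s (sigma n \<iota> s act) N"
  shows "lie_submodule gl_tilde s act N"
proof -
  have N: "subspace N" and stable: "\<And>x v. x \<in> gl_hat_sub n ell \<Longrightarrow> v \<in> N \<Longrightarrow> sigma n \<iota> s act x v \<in> N"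
    using sub by (auto simp: lie_submodule_def)
  have central_N: "central v \<in> N" if "v \<in> N" for v
    using stable[OF Kappa_in_gl_hat_sub that] by (simp add: sigma_single central_def)
  have diag_N: "diag k (\<lambda>b. ffact (\<iota> + of_int b) (r + ell j)) i j v \<in> N"
    if v: "v \<in> N" and ij: "i \<in> {1..n}" "j \<in> {1..n}" for v i j k r
  proof -
    \<comment> \<open>The power of \<open>t\<close> that puts the operator with \<open>r + ell j\<close> derivatives on the \<open>k\<close>-th diagonal.\<close>
    define m where "m = k + int (r + ell j)"
    define z where "z = (if i = j \<and> int (r + ell j) = m
        then - (ffact \<iota> (Suc (r + ell j)) / of_nat (Suc (r + ell j))) else 0)"
    have "sigma n \<iota> s act (basis (TD m (r + ell j) i j)) v \<in> N"
      by (intro stable TD_in_gl_hat_sub v ij)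
    then have "diag (m - int (r + ell j)) (\<lambda>b. ffact (\<iota> + of_int b) (r + ell j)) i j v + s z (central v) \<in> N"
      by (simp only: sigma_single scale_one sigma_basis_TD z_def)
    moreover have "m - int (r + ell j) = k" by (simp add: m_def)
    ultimately have "diag k (\<lambda>b. ffact (\<iota> + of_int b) (r + ell j)) i j v + s z (central v) - s z (central v) \<in> N"
      by (simp only: subspace_diff[OF N] subspace_scale[OF N] central_N[OF v])
    then show ?thesis by simp
  qed
  have unit_N: "unit i j a b v \<in> N" if v: "v \<in> N" and ij: "i \<in> {1..n}" "j \<in> {1..n}" for v i j a b
  proof -
    define k where "k = a - b"
    obtain K where K: "K \<ge> 0" "vanishes_beyond K v"
      using vanishes_beyond_exists by metis
    \<comment> \<open>Large enough for the range to contain both the support of the sum and the chosen index.\<close>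
    define M where "M = K + \<bar>k\<bar> + \<bar>b\<bar>"
    define x where "x b = \<iota> + of_int b - of_nat (ell j)" for b
    define w where "w b = s (ffact (\<iota> + of_int b) (ell j)) (unit i j (k + b) b v)" for b
    have "w b \<in> N"
    proof (rule moments_in_subspace[OF _ N, of "{- M..M}" x])
      show "vector_space s" by unfold_locales
      show "inj_on x {- M..M}" by (simp add: x_def inj_on_def)
      show "b \<in> {- M..M}" using K(1) by (auto simp: M_def)
      fix q
      have "(\<Sum>b\<in>{- M..M}. s (ffact (x b) q) (w b)) = diag k (\<lambda>b. ffact (\<iota> + of_int b) (q + ell j)) i j v"
      proof (subst diag_eq_sum[OF K(2) ij])
        show "K + \<bar>k\<bar> \<le> M" by (simp add: M_def)
      qed (simp_all add: w_def x_def ffact_add[of _ "ell j" q] add.commute[of q] mult.commute)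
      then show "(\<Sum>b\<in>{- M..M}. s (ffact (x b) q) (w b)) \<in> N"
        using diag_N[OF v ij] by simp
    qed simp
    moreover have "ffact (\<iota> + of_int b) (ell j) \<noteq> 0"
    proof (rule ffact_ne_0)
      show "\<iota> + of_int b \<notin> \<int>"
        using assms(1) Ints_diff[OF _ Ints_of_int, of "\<iota> + of_int b" b] by auto
    qed
    then have "unit i j (k + b) b v = s (inverse (ffact (\<iota> + of_int b) (ell j))) (w b)"
      by (simp add: w_def)
    ultimately show ?thesis
      using subspace_scale[OF N] by (simp add: k_def)
  qed
  have "act (basis b) v \<in> N" if v: "v \<in> N" and b: "basis b \<in> gl_tilde" for b v
  proof (cases b)
    case (EE l k)
    have "l \<in> half_ints" "- k \<in> half_ints"
      using b uminus_half_ints[of k] by (auto simp: gl_tilde_def EE)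
    then obtain i a j c where ij: "i \<in> {1..n}" "j \<in> {1..n}" and "l = hidx n i a" "- k = hidx n j c"
      using half_ints_hidx[OF n_pos] by metis
    then have "b = EE (hidx n i a) (- hidx n j c)"
      by (simp add: EE flip: \<open>- k = hidx n j c\<close>)
    then show ?thesis
      using unit_N[OF v ij] by (simp add: unit_def)
  next
    case Kappa0
    then show ?thesis using central_N[OF v] by (simp add: central_def)
  qed
  moreover have "basis b \<in> gl_tilde" if "x \<in> gl_tilde" "b \<in> Poly_Mapping.keys x" for x b
    using that by (auto simp: gl_tilde_def)
  ultimately have "act x v \<in> N" if "x \<in> gl_tilde" "v \<in> N" for x v
    unfolding act_basis_expansion[OF that(1)] using that
    by (intro subspace_sum subspace_scale N) blast
  then show ?thesis using N by (simp add: lie_submodule_def)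
qed

end

theorem theorem3p1:
  fixes n :: nat
    and ell :: "nat \<Rightarrow> nat"
    and s :: "complex \<Rightarrow> 'v::ab_group_add \<Rightarrow> 'v"
    and act :: "(tilde_index \<Rightarrow>\<^sub>0 complex) \<Rightarrow> 'v \<Rightarrow> 'v"
    and M0 :: "'v set"
    and \<iota> :: complex
  assumes n_pos: "n \<ge> 1"
    and M_module: "lie_module gl_tilde gl_tilde_bracket s act"
    and M_weighted: "weighted s act"
    and M0_subspace: "module.subspace s M0"
    and M0_generates: "lie_submodule gl_tilde s act hull M0 = UNIV"
    and M0_killed: "\<exists>m::nat. \<forall>x\<in>gl_tilde_trunc m. \<forall>v\<in>M0. act x v = 0"
    and iota_not_int: "\<iota> \<notin> \<int>"
  shows "irreducible_lie_module (gl_hat_sub n ell) gl_hat_bracket s (sigma n \<iota> s act)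
           \<longleftrightarrow> irreducible_lie_module gl_tilde gl_tilde_bracket s act"
proof -
  interpret M: gl_tilde_module s act
    using M_module by (simp add: gl_tilde_module_def)
  obtain m where m: "\<forall>x\<in>gl_tilde_trunc m. \<forall>v\<in>M0. act x v = 0"
    using M0_killed by blast
  interpret truncated_gl_tilde_module s act n
  proof
    show "n \<ge> 1" by (rule n_pos)
    fix v
    show "\<exists>m. \<forall>l1\<in>half_ints. \<forall>l2\<in>half_ints.
      l1 > of_nat m \<and> l2 < - of_nat m \<or> l1 < - of_nat m \<and> l2 > of_nat m \<longrightarrow> act (basis (EE l1 l2)) v = 0"
      by (rule M.locally_truncated[OF M0_generates m, of v]) blast
  qed
  have "lie_module (gl_hat_sub n ell) gl_hat_bracket s (sigma n \<iota> s act)"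
    by (rule lie_module_mono[OF sigma_lie_module gl_hat_sub_subset])
  moreover have "lie_submodule (gl_hat_sub n ell) s (sigma n \<iota> s act) N \<longleftrightarrow> lie_submodule gl_tilde s act N" for N
  proof
    show "lie_submodule (gl_hat_sub n ell) s (sigma n \<iota> s act) N \<Longrightarrow> lie_submodule gl_tilde s act N"
      by (rule sigma_submodule_is_submodule[OF iota_not_int])
    show "lie_submodule gl_tilde s act N \<Longrightarrow> lie_submodule (gl_hat_sub n ell) s (sigma n \<iota> s act) N"
      using M.sigma_in_submodule by (auto simp: lie_submodule_def)
  qed
  ultimately show ?thesis
    using M_module by (simp add: irreducible_lie_module_def)
qed

end
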